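(* Let $\gamma_s\le 1/6$ for all $s$, and set $a_0:=0$. Then $\lim_{s\to\infty}a_{j\cdot 2^s+n}=a_n$ for all $j\in\mathbb{N}$ and $n\in\mathbb{N}_0$. In particular, $\liminf_{n\to\infty} a_n=0$.
   Context: $\mathbb{N}_0=\mathbb{N}\cup\{0\}$. Let $\gamma=(\gamma_s)_{s=1}^\infty$ with $0<\gamma_s<1/4$ for all $s$. Put $r_0=1$ and $r_s=\gamma_s r_{s-1}^2$ for $s\ge 1$. Define polynomials recursively by $P_1(x)=x-1$ and $P_{2^{s+1}}(x)=P_{2^s}(x)\,(P_{2^s}(x)+r_s)$ for $s\in\mathbb{N}_0$. Let $E_s=\{x\in\mathbb{R}: P_{2^{s+1}}(x)\le 0\}$; then $E_{s+1}\subset E_s$ and $K(\gamma)=\bigcap_{s=0}^\infty E_s$ is a (compact) Cantor set. It is assumed throughout that $K(\gamma)$ has positive logarithmic capacity, $Cap(K(\gamma))=\exp\left(\sum_{k=1}^\infty 2^{-k}\log\gamma_k\right)>0$. $\mu_{K(\gamma)}$ is the equilibrium measure of $K(\gamma)$ and $Q_n$ is the monic orthogonal polynomial of degree $n$ with respect to $\mu_{K(\gamma)}$. The Jacobi parameters $a_n>0$, $b_n\in\mathbb{R}$ ($n\ge1$) are defined by $Q_{n+1}(x)=(x-b_{n+1})Q_n(x)-a_n^2Q_{n-1}(x)$, $n\in\mathbb{N}_0$, with $Q_{-1}=0$, $Q_0=1$; thus $a_1\cdots a_n$ is the $L^2(\mu_{K(\gamma)})$-norm of $Q_n$. *)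

theory Defs
  imports "HOL-Probability.Probability" "HOL-Computational_Algebra.Polynomial"
begin

section \<open>Logarithmic capacity and equilibrium measure\<close>

definition log_kernel :: "real \<Rightarrow> real \<Rightarrow> ereal" where
  "log_kernel x y = (if x = y then \<infinity> else ereal (ln (1 / \<bar>x - y\<bar>)))"

text \<open>The logarithmic energy is the double integral of \<^const>\<open>log_kernel\<close>, written as the integral of
  the positive part minus the integral of the negative part (\<^const>\<open>e2ennreal\<close> sends negative
  values to 0). The latter is finite for every finite measure concentrated on a bounded set, so the
  energy of such a measure is a well-defined element of the half-open interval from minus infinity
  (excluded) to infinity (included).\<close>

definition log_energy :: "real measure \<Rightarrow> ereal" where
  "log_energy M =
     enn2ereal (\<integral>\<^sup>+x. (\<integral>\<^sup>+y. e2ennreal (log_kernel x y) \<partial>M) \<partial>M)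
   - enn2ereal (\<integral>\<^sup>+x. (\<integral>\<^sup>+y. e2ennreal (- log_kernel x y) \<partial>M) \<partial>M)"

text \<open>For closed K, full mass on K is the same as having support contained in K.\<close>

definition prob_measures_on :: "real set \<Rightarrow> real measure set" where
  "prob_measures_on K = {M. sets M = sets borel \<and> prob_space M \<and> emeasure M K = 1}"

definition robin_constant :: "real set \<Rightarrow> ereal" where
  "robin_constant K = (INF M\<in>prob_measures_on K. log_energy M)"

text \<open>For compact K the Robin constant is never minus infinity; it is infinity exactly for sets of
  zero capacity (including the empty set).\<close>

definition log_capacity :: "real set \<Rightarrow> real" where
  "log_capacity K =
     (if robin_constant K = \<infinity> then 0 else exp (- real_of_ereal (robin_constant K)))"

text \<open>Meaningful for compact K of positive capacity, where the minimiser exists and is unique.\<close>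

definition is_equilibrium_measure :: "real set \<Rightarrow> real measure \<Rightarrow> bool" where
  "is_equilibrium_measure K M \<longleftrightarrow>
     M \<in> prob_measures_on K \<and> (\<forall>N\<in>prob_measures_on K. log_energy M \<le> log_energy N)"

section \<open>Monic orthogonal polynomials and Jacobi parameters\<close>

definition is_monic_orthogonal_polys :: "real measure \<Rightarrow> (nat \<Rightarrow> real poly) \<Rightarrow> bool" where
  "is_monic_orthogonal_polys M Q \<longleftrightarrow>
     (\<forall>n. degree (Q n) = n \<and> lead_coeff (Q n) = 1 \<and>
          (\<forall>p. degree p < n \<longrightarrow> (\<integral>x. poly (Q n) x * poly p x \<partial>M) = 0))"

text \<open>The first recurrence relation is the case n = 0, where the polynomial of index -1 is zero.\<close>

definition are_jacobi_parameters ::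
  "(nat \<Rightarrow> real poly) \<Rightarrow> (nat \<Rightarrow> real) \<Rightarrow> (nat \<Rightarrow> real) \<Rightarrow> bool" where
  "are_jacobi_parameters Q a b \<longleftrightarrow>
     (\<forall>n\<ge>1. a n > 0) \<and>
     Q 1 = [:- b 1, 1:] * Q 0 \<and>
     (\<forall>n\<ge>1. Q (n + 1) = [:- b (n + 1), 1:] * Q n - smult ((a n)\<^sup>2) (Q (n - 1)))"

section \<open>The weakly equilibrium Cantor set\<close>

text \<open>Only the values of \<open>\<gamma>\<close> at indices at least 1 are used.\<close>

fun cantor_r :: "(nat \<Rightarrow> real) \<Rightarrow> nat \<Rightarrow> real" where
  "cantor_r \<gamma> 0 = 1"
| "cantor_r \<gamma> (Suc s) = \<gamma> (Suc s) * (cantor_r \<gamma> s)\<^sup>2"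

text \<open>\<open>P2 \<gamma> s\<close> is the polynomial of degree \<open>2 ^ s\<close> of the construction, i.e. the polynomials are
  indexed by the exponent.\<close>

fun P2 :: "(nat \<Rightarrow> real) \<Rightarrow> nat \<Rightarrow> real poly" where
  "P2 \<gamma> 0 = [:-1, 1:]"
| "P2 \<gamma> (Suc s) = P2 \<gamma> s * (P2 \<gamma> s + [:cantor_r \<gamma> s:])"

definition cantor_E :: "(nat \<Rightarrow> real) \<Rightarrow> nat \<Rightarrow> real set" where
  "cantor_E \<gamma> s = {x. poly (P2 \<gamma> (s + 1)) x \<le> 0}"

definition cantor_K :: "(nat \<Rightarrow> real) \<Rightarrow> real set" where
  "cantor_K \<gamma> = (\<Inter>s. cantor_E \<gamma> s)"

end

theory Submission
  imports Defs
begin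

text \<open>
  Write \<open>r s\<close> for \<^const>\<open>cantor_r\<close> and fold the real line by \<open>x \<mapsto> x * (r s - x)\<close> at stage \<open>s\<close>.
  From index 1 on, the polynomials \<^const>\<open>P2\<close> are, up to sign, the iterates of these maps, so the
  Cantor set consists of the points whose orbit stays nonnegative, and each folding map carries the Cantor set
  of stage \<open>s\<close> two-to-one onto the one of stage \<open>s + 1\<close>. Everything follows from the reflection
  symmetry \<open>x \<mapsto> r s - x\<close> at every stage.

  The symmetry of the equilibrium measure comes from two facts. Since
  \<open>x (r - x) - y (r - y) = - (x - y) (x - (r - y))\<close>, the energy of the folded measure is the energy
  of \<open>M\<close> plus the mutual energy of \<open>M\<close> and its reflection; and every measure on the next Cantor set
  lifts to a symmetric measure of half the energy. As twice a mutual energy never exceeds the sum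
  of the two energies, folding an energy minimiser gives an energy minimiser, and the
  minimiser and its reflection satisfy that inequality with equality. On \<open>[0, 1]\<close> the kernel
  \<open>- ln |x - y|\<close> is a nonnegative superposition of products \<open>f x * f y\<close> of truncated powers, which
  gives both the inequality and the fact that equality forces all moments to agree
  (\<open>moments_eq\<close>, \<open>energy_minimiser_step\<close>).

  For a measure that is symmetric about \<open>r / 2\<close> all \<open>b n\<close> equal \<open>r / 2\<close>, the orthogonal
  polynomials of even degree are polynomials in \<open>x (r - x)\<close>, and these are the orthogonal
  polynomials of the folded measure (\<open>even_jacobi_functional\<close>). With \<open>A s n\<close> for the squared Jacobi
  parameters of stage \<open>s\<close> and \<open>A s 0 = 0\<close> this reads
  \<open>A s (2 n) + A s (2 n + 1) = (r s)\<^sup>2 / 4 - r (s + 1) / 2\<close> and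
  \<open>A s (2 n) * A s (2 n - 1) = A (s + 1) n\<close>.

  Dividing by \<open>(r s)\<^sup>2\<close> makes this recursion scale invariant. The hypothesis \<open>\<gamma> s \<le> 1 / 6\<close>
  keeps the even entries at most \<open>1 / 12\<close> and the odd ones at least \<open>1 / 12\<close>; hence an even entry is at most a third of the corresponding entry of the next stage, the entries at
  \<open>j * 2 ^ s\<close> decay geometrically, and the recursion carries the limit from smaller indices to
  larger ones (\<open>renormalised_limit\<close>). Along the powers of 2 the limit is \<open>a 0 = 0\<close>, which gives the
  limes inferior.
\<close>

section \<open>Positivity of the logarithmic energy on the unit interval\<close>

text \<open>On a subset of \<open>[0, 1]\<close> the logarithmic kernel is nonnegative, so its energy is a single
  integral of this extended nonnegative function of the distance.\<close>
definition neglog :: "real \<Rightarrow> ennreal" where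
  "neglog d = (if d = 0 then \<top> else ennreal (- ln d))"

lemma e2ennreal_log_kernel: "e2ennreal (log_kernel x y) = neglog \<bar>x - y\<bar>"
  by (auto simp: log_kernel_def neglog_def ln_div)

lemma measurable_neglog [measurable]: "neglog \<in> borel_measurable borel"
  unfolding neglog_def by measurable

lemma neglog_mult:
  assumes "0 \<le> a" "a \<le> 1" "0 \<le> b" "b \<le> 1"
  shows "neglog (a * b) = neglog a + neglog b"
  using assms by (auto simp: neglog_def ln_mult ln_le_zero_iff simp flip: ennreal_plus)

definition mutual_energy :: "real measure \<Rightarrow> real measure \<Rightarrow> ennreal" where
  "mutual_energy M N = (\<integral>\<^sup>+x. \<integral>\<^sup>+y. neglog \<bar>x - y\<bar> \<partial>N \<partial>M)"

text \<open>
  The kernel is positive definite on \<open>[0, 1]\<close> because it splits into positive rank-one pieces. With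
  \<open>y\<close> the larger of the two points,
  \<open>- ln |x - y| = - ln y + (\<Sum>m\<ge>1. (x / y) ^ m / m)\<close>, where \<open>- ln y\<close> is the integral of \<open>1 / b\<close> over
  \<open>[y, 1]\<close> and \<open>(x / y) ^ m / m\<close> is the integral of \<open>2 (x y) ^ m / b ^ (2 m + 1)\<close> over
  \<open>b \<ge> y\<close>. The condition \<open>b \<ge> y\<close> says that \<open>b\<close> exceeds both points, and so factors as well.
  All pieces are nonnegative, so sums and integrals may be exchanged freely.
\<close>
definition feature :: "nat \<Rightarrow> real \<Rightarrow> real \<Rightarrow> ennreal" where
  "feature m b x = (if x \<le> b then ennreal (x ^ m) else 0)"

definition weight :: "nat \<Rightarrow> real \<Rightarrow> ennreal" where
  "weight m b =
     (if m = 0 then ennreal (1 / b) * indicator {0<..1} b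
      else ennreal (2 / b ^ (2 * m + 1)) * indicator {0<..} b)"

lemma measurable_feature [measurable]:
  assumes [measurable]: "f \<in> borel_measurable M" "g \<in> borel_measurable M"
  shows "(\<lambda>z. feature m (f z) (g z)) \<in> borel_measurable M"
  unfolding feature_def by measurable

lemma measurable_weight [measurable]: "weight m \<in> borel_measurable borel"
  unfolding weight_def by measurable

lemma nn_integral_inverse_Icc:
  assumes "0 < y" "y \<le> 1"
  shows "(\<integral>\<^sup>+b. ennreal (1 / b) * indicator {y..1} b \<partial>lborel) = ennreal (- ln y)"
proof (rule nn_integral_has_integral_lebesgue')
  have "((\<lambda>b. 1 / b) has_integral ln 1 - ln y) {y..1}"
    using assms
    by (intro fundamental_theorem_of_calculus)
       (auto intro!: derivative_eq_intros simp: has_real_derivative_iff_has_vector_derivative[symmetric])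
  thus "((\<lambda>b. 1 / b) has_integral - ln y) {y..1}" by simp
qed (use assms in auto)

lemma feature_integral:
  assumes "0 \<le> x" "x \<le> y" "0 < y" "y \<le> 1"
  shows "(\<integral>\<^sup>+b. weight m b * (feature m b x * feature m b y) \<partial>lborel)
       = ennreal (if m = 0 then - ln y else (x / y) ^ m / m)"
proof (cases m)
  case 0
  have "(\<integral>\<^sup>+b. weight m b * (feature m b x * feature m b y) \<partial>lborel)
      = (\<integral>\<^sup>+b. ennreal (1 / b) * indicator {y..1} b \<partial>lborel)"
    using assms 0 by (intro nn_integral_cong) (auto simp: weight_def feature_def indicator_def)
  thus ?thesis using nn_integral_inverse_Icc[of y] assms 0 by simp
next
  case (Suc k)
  let ?f = "\<lambda>b. 2 * (x * y) ^ m / b ^ (2 * m + 1)"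
  let ?F = "\<lambda>b. - ((x * y) ^ m / m) / b ^ (2 * m)"
  have "(\<integral>\<^sup>+b. weight m b * (feature m b x * feature m b y) \<partial>lborel)
      = (\<integral>\<^sup>+b. ennreal (?f b) * indicator {y..} b \<partial>lborel)"
    using assms Suc
    by (intro nn_integral_cong)
       (auto simp: weight_def feature_def indicator_def power_mult_distrib simp flip: ennreal_mult)
  also have "\<dots> = ennreal (0 - ?F y)"
  proof (rule nn_integral_FTC_atLeast[where F = ?F])
    show "?f \<in> borel_measurable borel" by measurable
    show "(?F has_real_derivative ?f b) (at b)" if "y \<le> b" for b
    proof -
      have b: "b > 0" and m: "m > 0" using that assms Suc by simp_all
      obtain j where j: "2 * m = Suc j" using Suc by simp
      have d: "(?F has_real_derivative ((x * y) ^ m / m) * (real (2 * m) * b ^ j) / (b ^ (2 * m) * b ^ (2 * m))) (at b)"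
        unfolding j using b m by (auto intro!: derivative_eq_intros simp del: power_Suc)
      have "((x * y) ^ m / m) * (real (2 * m) * b ^ j) / (b ^ (2 * m) * b ^ (2 * m)) = ?f b"
      proof -
        have "b ^ (2 * m) = b * b ^ j" unfolding j by simp
        thus ?thesis using b m by simp
      qed
      from DERIV_cong[OF d this] show ?thesis .
    qed
    show "0 \<le> ?f b" if "y \<le> b" for b using that assms by simp
    show "(?F \<longlongrightarrow> 0) at_top"
      using Suc
      by (intro real_tendsto_divide_at_top[OF tendsto_const] filterlim_pow_at_top filterlim_ident) auto
  qed
  also have "0 - ?F y = (x / y) ^ m / m"
    using assms by (simp add: field_simps power_mult power2_eq_square power_mult_distrib)
  finally show ?thesis using Suc by simp
qed

text \<open>The expansion is valid on the diagonal too: both sides are infinite there, through the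
  harmonic series when \<open>y > 0\<close> and through the integral of \<open>1 / b\<close> near \<open>0\<close> when \<open>y = 0\<close>.\<close>
lemma neglog_expansion_ordered:
  assumes "0 \<le> x" "x \<le> y" "y \<le> 1"
  shows "(\<Sum>m. \<integral>\<^sup>+b. weight m b * (feature m b x * feature m b y) \<partial>lborel) = neglog \<bar>x - y\<bar>"
proof -
  let ?I = "\<lambda>m. \<integral>\<^sup>+b. weight m b * (feature m b x * feature m b y) \<partial>lborel"
  let ?c = "\<lambda>m. if m = 0 then - ln y else (x / y) ^ m / m"
  \<comment> \<open>The rule \<open>suminf_ennreal\<close> is disabled below: its premise contains its own left-hand side,
      which sends the simplifier into a loop.\<close>
  consider "y = 0" | "0 < y" "x < y" | "0 < y" "x = y" using assms by fastforce
  thus ?thesis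
  proof cases
    case 1
    have "ennreal C \<le> ?I 0" if "C \<ge> 0" for C
    proof -
      have "ennreal C = (\<integral>\<^sup>+b. ennreal (1 / b) * indicator {exp (- C)..1} b \<partial>lborel)"
        using nn_integral_inverse_Icc[of "exp (- C)"] that by simp
      also have "\<dots> \<le> ?I 0"
        using assms 1 order.strict_trans2[OF exp_gt_zero[of "- C"]]
        by (intro nn_integral_mono) (auto simp: weight_def feature_def indicator_def)
      finally show ?thesis .
    qed
    hence "?I 0 = \<top>"
    proof (cases "?I 0" rule: ennreal_cases)
      case (real c)
      then show ?thesis using \<open>\<And>C. C \<ge> 0 \<Longrightarrow> ennreal C \<le> ?I 0\<close>[of "c + 1"] by simp
    qed
    moreover have "?I 0 \<le> (\<Sum>m. ?I m)"
      using sum_le_suminf[OF summableI, of "{0}" ?I] by simp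
    ultimately show ?thesis using 1 assms by (simp add: neglog_def top_unique)
  next
    case 2
    have "(\<lambda>m. - ((- (- (x / y))) ^ m) / real m) sums ln (1 + - (x / y))"
      by (rule ln_series') (use 2 assms in simp)
    hence "(\<lambda>m. - ((x / y) ^ m) / real m) sums ln (1 - x / y)" by simp
    from sums_diff[OF sums_single[of 0 "\<lambda>_. - ln y"] this]
    have "(\<lambda>m. (if m = 0 then - ln y else 0) - - ((x / y) ^ m) / real m) sums (- ln y - ln (1 - x / y))" .
    moreover have "(\<lambda>m. (if m = 0 then - ln y else 0) - - ((x / y) ^ m) / real m) = ?c"
      by (rule ext) simp
    moreover have "- ln y - ln (1 - x / y) = - ln (y - x)"
    proof -
      have "y * (1 - x / y) = y - x" using 2 by (simp add: right_diff_distrib)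
      moreover have "1 - x / y > 0" using 2 by simp
      ultimately show ?thesis using 2 ln_mult[of y "1 - x / y"] by simp
    qed
    ultimately have "?c sums - ln (y - x)" by (simp only:)
    moreover have "0 \<le> ?c m" for m using assms 2 by simp
    ultimately have "(\<Sum>m. ennreal (?c m)) = ennreal (- ln (y - x))"
      by (rule suminf_ennreal_eq[rotated])
    moreover have "?I m = ennreal (?c m)" for m
      by (rule feature_integral) (use assms 2 in auto)
    ultimately show ?thesis using 2 by (simp add: neglog_def del: suminf_ennreal)
  next
    case 3
    have "(\<Sum>m. ennreal (?c m)) = \<top>"
    proof (rule ccontr)
      assume "(\<Sum>m. ennreal (?c m)) \<noteq> \<top>"
      hence "summable ?c" using assms 3 by (intro summable_suminf_not_top) (auto simp del: suminf_ennreal)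
      hence "summable (\<lambda>m. ?c (Suc m))" by (subst summable_Suc_iff)
      hence "summable (\<lambda>m. inverse (real (Suc m)))" using 3 by (simp add: inverse_eq_divide)
      thus False using not_summable_harmonic[where ?'a = real]
        by (subst (asm) summable_Suc_iff[of "\<lambda>m. inverse (real m)"]) simp
    qed
    moreover have "?I m = ennreal (?c m)" for m
      by (rule feature_integral) (use assms 3 in auto)
    ultimately show ?thesis using 3 by (simp add: neglog_def del: suminf_ennreal)
  qed
qed

lemma neglog_expansion:
  assumes "x \<in> {0..1}" "y \<in> {0..1}"
  shows "(\<Sum>m. \<integral>\<^sup>+b. weight m b * (feature m b x * feature m b y) \<partial>lborel) = neglog \<bar>x - y\<bar>"
proof (cases "x \<le> y")
  case True
  then show ?thesis using neglog_expansion_ordered[of x y] assms by simp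
next
  case False
  then show ?thesis using neglog_expansion_ordered[of y x] assms
    by (simp add: abs_minus_commute mult.commute[of "feature _ _ x"])
qed

lemma prob_measures_onD:
  assumes "M \<in> prob_measures_on S"
  shows "sets M = sets borel" "prob_space M" "AE x in M. x \<in> S"
proof -
  show M: "sets M = sets borel" "prob_space M"
    using assms by (auto simp: prob_measures_on_def)
  interpret prob_space M by fact
  have S: "emeasure M S = 1" using assms by (simp add: prob_measures_on_def)
  hence "S \<in> sets M" using emeasure_notin_sets[of S M] by fastforce
  moreover have "prob S = 1" using S by (simp add: measure_def)
  ultimately show "AE x in M. x \<in> S" using prob_eq_1[of S] by simp
qed

lemma prob_measures_onI:
  assumes "sets M = sets borel" "prob_space M" "AE x in M. x \<in> S" "S \<in> sets borel"
  shows "M \<in> prob_measures_on S"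
proof -
  interpret prob_space M by fact
  have "emeasure M S = 1"
    using assms prob_eq_1[of S] by (simp add: emeasure_eq_measure)
  thus ?thesis using assms by (simp add: prob_measures_on_def)
qed

lemma prob_measures_on_mono:
  assumes "M \<in> prob_measures_on S" "S \<subseteq> T" "T \<in> sets borel"
  shows "M \<in> prob_measures_on T"
  using prob_measures_onD[OF assms(1)] assms(2,3)
  by (intro prob_measures_onI) (auto elim!: eventually_mono)

lemma mutual_energy_expansion:
  assumes M: "M \<in> prob_measures_on {0..1}" and N: "N \<in> prob_measures_on {0..1}"
  shows "mutual_energy M N =
    (\<Sum>m. \<integral>\<^sup>+b. weight m b * ((\<integral>\<^sup>+x. feature m b x \<partial>M) * (\<integral>\<^sup>+y. feature m b y \<partial>N)) \<partial>lborel)"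
proof -
  note [measurable_cong] = prob_measures_onD(1)[OF M] prob_measures_onD(1)[OF N]
  interpret M: prob_space M using prob_measures_onD(2)[OF M] .
  interpret N: prob_space N using prob_measures_onD(2)[OF N] .
  interpret LM: pair_sigma_finite lborel M ..
  interpret LN: pair_sigma_finite lborel N ..
  have "mutual_energy M N =
      (\<integral>\<^sup>+x. \<integral>\<^sup>+y. (\<Sum>m. \<integral>\<^sup>+b. weight m b * (feature m b x * feature m b y) \<partial>lborel) \<partial>N \<partial>M)"
    unfolding mutual_energy_def
  proof (rule nn_integral_cong_AE, use prob_measures_onD(3)[OF M] in eventually_elim)
    case (elim x)
    show ?case
      by (rule nn_integral_cong_AE, use prob_measures_onD(3)[OF N] in eventually_elim)
         (use elim neglog_expansion in simp)
  qed
  also have "\<dots> = (\<integral>\<^sup>+x. (\<Sum>m. \<integral>\<^sup>+y. \<integral>\<^sup>+b. weight m b * (feature m b x * feature m b y) \<partial>lborel \<partial>N) \<partial>M)"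
    by (intro nn_integral_cong nn_integral_suminf) measurable
  also have "\<dots> = (\<integral>\<^sup>+x. (\<Sum>m. \<integral>\<^sup>+b. \<integral>\<^sup>+y. weight m b * (feature m b x * feature m b y) \<partial>N \<partial>lborel) \<partial>M)"
    by (intro nn_integral_cong suminf_cong LN.Fubini') measurable
  also have "\<dots> = (\<integral>\<^sup>+x. (\<Sum>m. \<integral>\<^sup>+b. weight m b * feature m b x * (\<integral>\<^sup>+y. feature m b y \<partial>N) \<partial>lborel) \<partial>M)"
    by (simp add: nn_integral_cmult flip: mult.assoc)
  also have "\<dots> = (\<Sum>m. \<integral>\<^sup>+x. \<integral>\<^sup>+b. weight m b * feature m b x * (\<integral>\<^sup>+y. feature m b y \<partial>N) \<partial>lborel \<partial>M)"
    by (intro nn_integral_suminf) measurable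
  also have "\<dots> = (\<Sum>m. \<integral>\<^sup>+b. \<integral>\<^sup>+x. weight m b * feature m b x * (\<integral>\<^sup>+y. feature m b y \<partial>N) \<partial>M \<partial>lborel)"
    by (intro suminf_cong LM.Fubini') measurable
  also have "\<dots> = (\<Sum>m. \<integral>\<^sup>+b. weight m b * ((\<integral>\<^sup>+x. feature m b x \<partial>M) * (\<integral>\<^sup>+y. feature m b y \<partial>N)) \<partial>lborel)"
    by (simp add: nn_integral_cmult nn_integral_multc mult.assoc)
  finally show ?thesis .
qed

lemma integrable_power_unit:
  assumes "M \<in> prob_measures_on {0..1}"
  shows "integrable M (\<lambda>x. x ^ m)"
proof -
  note [measurable_cong] = prob_measures_onD(1)[OF assms]
  interpret prob_space M using prob_measures_onD(2)[OF assms] .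
  show ?thesis
    by (rule integrable_const_bound[of _ 1], use prob_measures_onD(3)[OF assms] in eventually_elim)
       (auto simp: power_le_one)
qed

lemma integral_feature_le_1:
  assumes "M \<in> prob_measures_on {0..1}"
  shows "(\<integral>\<^sup>+x. feature m b x \<partial>M) \<le> 1"
proof -
  interpret prob_space M using prob_measures_onD(2)[OF assms] .
  have "(\<integral>\<^sup>+x. feature m b x \<partial>M) \<le> (\<integral>\<^sup>+x. 1 \<partial>M)"
    by (rule nn_integral_mono_AE, use prob_measures_onD(3)[OF assms] in eventually_elim)
       (auto simp: feature_def power_le_one)
  thus ?thesis by (simp add: emeasure_space_1)
qed

lemma integral_feature_eq_moment:
  assumes M: "M \<in> prob_measures_on {0..1}" and "b \<ge> 1"
  shows "(\<integral>\<^sup>+x. feature m b x \<partial>M) = ennreal (\<integral>x. x ^ m \<partial>M)"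
proof -
  have "(\<integral>\<^sup>+x. feature m b x \<partial>M) = (\<integral>\<^sup>+x. ennreal (x ^ m) \<partial>M)"
    by (rule nn_integral_cong_AE, use prob_measures_onD(3)[OF M] in eventually_elim)
       (use assms in \<open>auto simp: feature_def\<close>)
  also have "\<dots> = ennreal (\<integral>x. x ^ m \<partial>M)"
  proof (rule nn_integral_eq_integral[OF integrable_power_unit[OF M]])
    show "AE x in M. 0 \<le> x ^ m"
      using prob_measures_onD(3)[OF M] by eventually_elim simp
  qed
  finally show ?thesis .
qed

definition energy_gap :: "real measure \<Rightarrow> real measure \<Rightarrow> nat \<Rightarrow> ennreal" where
  "energy_gap M N m = (\<integral>\<^sup>+b. weight m b *
     ennreal ((enn2real (\<integral>\<^sup>+x. feature m b x \<partial>M) - enn2real (\<integral>\<^sup>+x. feature m b x \<partial>N))\<^sup>2) \<partial>lborel)"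

text \<open>Integrating \<open>u\<^sup>2 + v\<^sup>2 = 2 u v + (u - v)\<^sup>2\<close> against the weights, with \<open>u\<close> and \<open>v\<close> the integrals
  of a feature against the two measures. Stated as a sum, it remains meaningful when some of
  the energies are infinite.\<close>
lemma mutual_energy_polarisation:
  assumes M: "M \<in> prob_measures_on {0..1}" and N: "N \<in> prob_measures_on {0..1}"
  shows "mutual_energy M M + mutual_energy N N = 2 * mutual_energy M N + (\<Sum>m. energy_gap M N m)"
proof -
  note [measurable_cong] = prob_measures_onD(1)[OF M] prob_measures_onD(1)[OF N]
  interpret M: prob_space M using prob_measures_onD(2)[OF M] .
  interpret N: prob_space N using prob_measures_onD(2)[OF N] .
  define F where "F = (\<lambda>m b. \<integral>\<^sup>+x. feature m b x \<partial>M)"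
  define G where "G = (\<lambda>m b. \<integral>\<^sup>+x. feature m b x \<partial>N)"
  have [measurable]: "F m \<in> borel_measurable borel" "G m \<in> borel_measurable borel" for m
    unfolding F_def G_def by measurable
  have fold: "(\<integral>\<^sup>+x. feature m b x \<partial>M) = F m b" "(\<integral>\<^sup>+x. feature m b x \<partial>N) = G m b" for m b
    by (simp_all add: F_def G_def)
  have square: "F m b * F m b + G m b * G m b
      = 2 * (F m b * G m b) + ennreal ((enn2real (F m b) - enn2real (G m b))\<^sup>2)" for m b
  proof -
    obtain u v where "F m b = ennreal u" "u \<ge> 0" "G m b = ennreal v" "v \<ge> 0"
      using integral_feature_le_1[OF M, of m b] integral_feature_le_1[OF N, of m b]
      unfolding F_def G_def by (metis ennreal_cases ennreal_one_neq_top top_unique)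
    moreover have "u * u + v * v = 2 * (u * v) + (u - v)\<^sup>2"
      by (simp add: power2_eq_square algebra_simps)
    ultimately show ?thesis
      by (simp flip: ennreal_mult ennreal_plus ennreal_numeral)
  qed
  have "mutual_energy M M + mutual_energy N N
      = (\<Sum>m. \<integral>\<^sup>+b. weight m b * (F m b * F m b + G m b * G m b) \<partial>lborel)"
    unfolding mutual_energy_expansion[OF M M] mutual_energy_expansion[OF N N] fold
    by (simp add: suminf_add nn_integral_add distrib_left)
  also have "\<dots> = (\<Sum>m. 2 * (\<integral>\<^sup>+b. weight m b * (F m b * G m b) \<partial>lborel) + energy_gap M N m)"
  proof (rule suminf_cong)
    fix m
    have "weight m b * (F m b * F m b + G m b * G m b) = 2 * (weight m b * (F m b * G m b))
        + weight m b * ennreal ((enn2real (F m b) - enn2real (G m b))\<^sup>2)" for b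
      unfolding square by (simp only: distrib_left mult.left_commute)
    hence "(\<integral>\<^sup>+b. weight m b * (F m b * F m b + G m b * G m b) \<partial>lborel)
        = (\<integral>\<^sup>+b. 2 * (weight m b * (F m b * G m b)) \<partial>lborel)
        + (\<integral>\<^sup>+b. weight m b * ennreal ((enn2real (F m b) - enn2real (G m b))\<^sup>2) \<partial>lborel)"
      by (simp only: nn_integral_add[symmetric]) (intro nn_integral_add; measurable)
    thus "(\<integral>\<^sup>+b. weight m b * (F m b * F m b + G m b * G m b) \<partial>lborel)
        = 2 * (\<integral>\<^sup>+b. weight m b * (F m b * G m b) \<partial>lborel) + energy_gap M N m"
      unfolding energy_gap_def fold by (subst (asm) nn_integral_cmult) measurable
  qed
  also have "\<dots> = 2 * mutual_energy M N + (\<Sum>m. energy_gap M N m)"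
    unfolding mutual_energy_expansion[OF M N] fold
    by (simp only: ennreal_suminf_cmult suminf_add[OF summableI summableI, symmetric])
  finally show ?thesis .
qed

lemma mutual_energy_le:
  assumes "M \<in> prob_measures_on {0..1}" "N \<in> prob_measures_on {0..1}"
  shows "2 * mutual_energy M N \<le> mutual_energy M M + mutual_energy N N"
  using mutual_energy_polarisation[OF assms] by simp

text \<open>For finite energies, equality in the inequality above makes every \<^const>\<open>energy_gap\<close> vanish. For
  \<open>b \<ge> 1\<close> the truncation of the feature has no effect on \<open>[0, 1]\<close>, so for \<open>m \<ge> 1\<close> the part of the gap
  over \<open>1 \<le> b \<le> 2\<close> is a positive multiple of the squared difference of the moments.\<close>
lemma moments_eq:
  assumes M: "M \<in> prob_measures_on {0..1}" and N: "N \<in> prob_measures_on {0..1}"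
    and finite: "mutual_energy M M + mutual_energy N N \<noteq> \<top>"
    and le: "mutual_energy M M + mutual_energy N N \<le> 2 * mutual_energy M N"
  shows "(\<integral>x. x ^ m \<partial>M) = (\<integral>x. x ^ m \<partial>N)"
proof (cases m)
  case 0
  interpret M: prob_space M using prob_measures_onD(2)[OF M] .
  interpret N: prob_space N using prob_measures_onD(2)[OF N] .
  show ?thesis using 0 M.prob_space N.prob_space by simp
next
  case (Suc k)
  define d where "d = (\<integral>x. x ^ m \<partial>M) - (\<integral>x. x ^ m \<partial>N)"
  have nonneg: "(\<integral>x. x ^ m \<partial>M) \<ge> 0" "(\<integral>x. x ^ m \<partial>N) \<ge> 0"
    by (rule integral_nonneg_AE, use prob_measures_onD(3)[OF M] in eventually_elim, simp,
        rule integral_nonneg_AE, use prob_measures_onD(3)[OF N] in eventually_elim, simp)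
  have "2 * mutual_energy M N \<noteq> \<top>"
    using finite mutual_energy_le[OF M N] by (metis top_unique)
  with le have gap: "(\<Sum>m. energy_gap M N m) = 0"
    unfolding mutual_energy_polarisation[OF M N]
    using ennreal_add_left_cancel_le[of "2 * mutual_energy M N" _ 0] by (simp del: suminf_ennreal)
  \<comment> \<open>On \<open>[1, 2]\<close> the weight is smallest at \<open>b = 2\<close>.\<close>
  have "ennreal (2 / 2 ^ (2 * m + 1) * d\<^sup>2) =
      (\<integral>\<^sup>+b. ennreal (2 / 2 ^ (2 * m + 1) * d\<^sup>2) * indicator {1..2::real} b \<partial>lborel)"
    by (simp add: nn_integral_cmult_indicator)
  also have "\<dots> \<le> energy_gap M N m"
    unfolding energy_gap_def
  proof (intro nn_integral_mono)
    fix b :: real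
    show "ennreal (2 / 2 ^ (2 * m + 1) * d\<^sup>2) * indicator {1..2} b \<le> weight m b *
     ennreal ((enn2real (\<integral>\<^sup>+x. feature m b x \<partial>M) - enn2real (\<integral>\<^sup>+x. feature m b x \<partial>N))\<^sup>2)"
    proof (cases "b \<in> {1..2}")
      case True
      have "2 / 2 ^ (2 * m + 1) * d\<^sup>2 \<le> 2 / b ^ (2 * m + 1) * d\<^sup>2"
        using True by (intro mult_right_mono divide_left_mono power_mono mult_pos_pos) auto
      thus ?thesis
        using True Suc nonneg integral_feature_eq_moment[OF M, of b m] integral_feature_eq_moment[OF N, of b m]
        by (simp add: weight_def d_def flip: ennreal_mult')
    qed simp
  qed
  also have "energy_gap M N m = 0"
    using sum_le_suminf[OF summableI, of "{m}" "energy_gap M N"] gap by simp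
  finally show ?thesis by (simp add: d_def)
qed

section \<open>Energy minimisers and the folding map\<close>

definition energy_minimiser :: "real set \<Rightarrow> real measure \<Rightarrow> bool" where
  "energy_minimiser S M \<longleftrightarrow> M \<in> prob_measures_on S \<and> mutual_energy M M \<noteq> \<top> \<and>
     (\<forall>N\<in>prob_measures_on S. mutual_energy M M \<le> mutual_energy N N)"

lemma integral_poly_eq:
  assumes M: "M \<in> prob_measures_on {0..1}" and N: "N \<in> prob_measures_on {0..1}"
    and moments: "\<And>m. (\<integral>x. x ^ m \<partial>M) = (\<integral>x. x ^ m \<partial>N)"
  shows "(\<integral>x. poly p x \<partial>M) = (\<integral>x. poly p x \<partial>N)"
  unfolding poly_altdef using integrable_power_unit[OF M] integrable_power_unit[OF N] moments
  by (simp add: Bochner_Integration.integral_sum)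

text \<open>The two inverse branches of the folding map \<open>x \<mapsto> x * (r - x)\<close>.\<close>
definition preimage_branch :: "real \<Rightarrow> bool \<Rightarrow> real \<Rightarrow> real" where
  "preimage_branch r e v = (r + (if e then 1 else - 1) * sqrt (r\<^sup>2 - 4 * v)) / 2"

lemma measurable_preimage_branch [measurable]: "preimage_branch r e \<in> borel_measurable borel"
  unfolding preimage_branch_def by measurable

lemma preimage_branch:
  assumes "0 \<le> v" "v \<le> r\<^sup>2 / 4" "0 \<le> r"
  shows "preimage_branch r e v \<in> {0..r}"
    and "preimage_branch r e v * (r - preimage_branch r e v) = v"
    and "(w - preimage_branch r True v) * (w - preimage_branch r False v) = v - w * (r - w)"
proof -
  define q where "q = sqrt (r\<^sup>2 - 4 * v)"
  have "q\<^sup>2 = r\<^sup>2 - 4 * v" "0 \<le> q" using assms by (simp_all add: q_def)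
  moreover have "q \<le> r" unfolding q_def using assms by (intro real_le_lsqrt) auto
  ultimately show "preimage_branch r e v \<in> {0..r}"
    and "preimage_branch r e v * (r - preimage_branch r e v) = v"
    and "(w - preimage_branch r True v) * (w - preimage_branch r False v) = v - w * (r - w)"
    unfolding preimage_branch_def q_def[symmetric]
    by (auto simp: field_simps power2_eq_square)
qed

text \<open>A point of the next stage is pulled back to one of its two preimages by a fair coin.\<close>
definition symmetric_lift :: "real \<Rightarrow> real measure \<Rightarrow> real measure" where
  "symmetric_lift r N = distr (N \<Otimes>\<^sub>M measure_pmf (bernoulli_pmf (1 / 2))) borel
     (\<lambda>(v, e). preimage_branch r e v)"

lemma measurable_preimage_branch_pair:
  assumes [measurable_cong]: "sets N = sets borel"
  shows "(\<lambda>(v, e). preimage_branch r e v) \<in> borel_measurable (N \<Otimes>\<^sub>M measure_pmf p)"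
proof -
  have [measurable]: "snd \<in> N \<Otimes>\<^sub>M measure_pmf p \<rightarrow>\<^sub>M count_space UNIV"
    using measurable_snd[of N "measure_pmf p"] by simp
  show ?thesis unfolding preimage_branch_def case_prod_beta by measurable
qed

lemma sets_symmetric_lift [simp]: "sets (symmetric_lift r N) = sets borel"
  by (simp add: symmetric_lift_def)

lemma nn_integral_symmetric_lift:
  assumes N [measurable_cong]: "sets N = sets borel"
    and [measurable]: "f \<in> borel_measurable borel"
  shows "(\<integral>\<^sup>+x. f x \<partial>symmetric_lift r N)
       = (\<integral>\<^sup>+v. (f (preimage_branch r True v) + f (preimage_branch r False v)) / 2 \<partial>N)"
proof -
  note [measurable] = measurable_preimage_branch_pair[OF N]
  have "(\<integral>\<^sup>+x. f x \<partial>symmetric_lift r N)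
      = (\<integral>\<^sup>+v. \<integral>\<^sup>+e. f (preimage_branch r e v) \<partial>measure_pmf (bernoulli_pmf (1 / 2)) \<partial>N)"
    unfolding symmetric_lift_def
    using measurable_compose[OF measurable_preimage_branch_pair[OF N] assms(2)]
    by (subst nn_integral_distr, measurable, subst measure_pmf.nn_integral_fst[symmetric]) simp_all
  also have "\<dots> = (\<integral>\<^sup>+v. (f (preimage_branch r True v) + f (preimage_branch r False v)) / 2 \<partial>N)"
    by (intro nn_integral_cong)
       (simp add: ennreal_divide_times ennreal_times_divide divide_ennreal_def add_divide_distrib_ennreal distrib_left mult.commute flip: divide_ennreal)
  finally show ?thesis .
qed

lemma symmetric_lift_on:
  assumes N: "N \<in> prob_measures_on S'" and S: "S \<in> sets borel"
    and lift: "\<And>e v. v \<in> S' \<Longrightarrow> preimage_branch r e v \<in> S"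
  shows "symmetric_lift r N \<in> prob_measures_on S"
proof (rule prob_measures_onI)
  note [measurable_cong] = prob_measures_onD(1)[OF N]
  note [measurable] = measurable_preimage_branch_pair[OF prob_measures_onD(1)[OF N]]
  interpret N: prob_space N using prob_measures_onD(2)[OF N] .
  interpret P: pair_prob_space N "measure_pmf (bernoulli_pmf (1 / 2))" ..
  show "prob_space (symmetric_lift r N)"
    unfolding symmetric_lift_def by (rule P.prob_space_distr) measurable
  have [measurable]: "- S \<in> sets borel" using S by simp
  have "(\<integral>\<^sup>+x. indicator (- S) x \<partial>symmetric_lift r N) = 0"
  proof -
    have "(\<integral>\<^sup>+x. indicator (- S) x \<partial>symmetric_lift r N) = (\<integral>\<^sup>+v. (indicator (- S) (preimage_branch r True v)
        + indicator (- S) (preimage_branch r False v)) / 2 \<partial>N)"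
      using S by (intro nn_integral_symmetric_lift prob_measures_onD(1)[OF N]) auto
    also have "\<dots> = (\<integral>\<^sup>+v. 0 \<partial>N)"
      by (rule nn_integral_cong_AE, use prob_measures_onD(3)[OF N] in eventually_elim)
         (use lift in simp)
    finally show ?thesis by simp
  qed
  hence "AE x in symmetric_lift r N. indicator (- S) x = (0 :: ennreal)"
    by (subst (asm) nn_integral_0_iff_AE) (auto simp: measurable_cong_sets[OF sets_symmetric_lift refl])
  thus "AE x in symmetric_lift r N. x \<in> S"
    by eventually_elim (auto simp: indicator_def split: if_splits)
qed (use S in auto)

text \<open>For \<open>w\<close> in \<open>[0, r]\<close> the distances from \<open>w\<close> to the two preimages of \<open>v\<close> multiply to the distance
  between \<open>w * (r - w)\<close> and \<open>v\<close>. Averaging over the preimages therefore halves the kernel.\<close>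
lemma mutual_energy_symmetric_lift:
  assumes N: "N \<in> prob_measures_on {0..r\<^sup>2 / 4}" and r: "0 \<le> r" "r \<le> 1"
  shows "2 * mutual_energy (symmetric_lift r N) (symmetric_lift r N) = mutual_energy N N"
proof -
  note sN [measurable_cong] = prob_measures_onD(1)[OF N]
  interpret N: prob_space N using prob_measures_onD(2)[OF N] .
  let ?g = "preimage_branch r"
  have pair: "neglog \<bar>w - ?g True v\<bar> + neglog \<bar>w - ?g False v\<bar> = neglog \<bar>w * (r - w) - v\<bar>"
    if "w \<in> {0..r}" "v \<in> {0..r\<^sup>2 / 4}" for w v
  proof -
    have "?g True v \<in> {0..r}" "?g False v \<in> {0..r}"
      using preimage_branch(1)[of v r] that r by auto
    hence "neglog \<bar>w - ?g True v\<bar> + neglog \<bar>w - ?g False v\<bar>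
        = neglog (\<bar>w - ?g True v\<bar> * \<bar>w - ?g False v\<bar>)"
      using that r by (intro neglog_mult[symmetric]) auto
    also have "\<bar>w - ?g True v\<bar> * \<bar>w - ?g False v\<bar> = \<bar>w * (r - w) - v\<bar>"
      using preimage_branch(3)[of v r w] that r by (simp flip: abs_mult)
    finally show ?thesis .
  qed
  define U where "U = (\<lambda>w. \<integral>\<^sup>+v. neglog \<bar>w - v\<bar> \<partial>N)"
  have [measurable]: "U \<in> borel_measurable borel" unfolding U_def by measurable
  have inner: "(\<integral>\<^sup>+y. neglog \<bar>x - y\<bar> \<partial>symmetric_lift r N) = U (x * (r - x)) / 2"
    if "x \<in> {0..r}" for x
  proof -
    have "(\<integral>\<^sup>+y. neglog \<bar>x - y\<bar> \<partial>symmetric_lift r N)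
        = (\<integral>\<^sup>+v. (neglog \<bar>x - ?g True v\<bar> + neglog \<bar>x - ?g False v\<bar>) / 2 \<partial>N)"
      by (intro nn_integral_symmetric_lift sN) measurable
    also have "\<dots> = (\<integral>\<^sup>+v. neglog \<bar>x * (r - x) - v\<bar> / 2 \<partial>N)"
      by (rule nn_integral_cong_AE, use prob_measures_onD(3)[OF N] in eventually_elim)
         (use pair that in simp)
    also have "\<dots> = U (x * (r - x)) / 2"
      unfolding U_def by (intro nn_integral_divide) measurable
    finally show ?thesis .
  qed
  have lift: "symmetric_lift r N \<in> prob_measures_on {0..r}"
    using preimage_branch(1) r by (intro symmetric_lift_on[OF N]) auto
  have "mutual_energy (symmetric_lift r N) (symmetric_lift r N)
      = (\<integral>\<^sup>+x. U (x * (r - x)) / 2 \<partial>symmetric_lift r N)"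
    unfolding mutual_energy_def
    by (rule nn_integral_cong_AE, use prob_measures_onD(3)[OF lift] in eventually_elim)
       (use inner in simp)
  also have "\<dots> = (\<integral>\<^sup>+v. (U (?g True v * (r - ?g True v)) / 2 + U (?g False v * (r - ?g False v)) / 2) / 2 \<partial>N)"
    by (intro nn_integral_symmetric_lift sN) measurable
  also have "\<dots> = (\<integral>\<^sup>+v. U v / 2 \<partial>N)"
  proof (rule nn_integral_cong_AE, use prob_measures_onD(3)[OF N] in eventually_elim)
    case (elim v)
    have "U v / 2 + U v / 2 = U v"
      by (simp add: ennreal_divide_times ennreal_divide_self flip: mult_2_right)
    thus ?case using preimage_branch(2)[of v r] elim r by simp
  qed
  also have "\<dots> = mutual_energy N N / 2"
    unfolding mutual_energy_def U_def[symmetric] by (intro nn_integral_divide) measurable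
  finally show ?thesis
    by (simp add: mult.commute[of 2] ennreal_divide_times)
qed

lemma mutual_energy_distr:
  assumes M: "sets M = sets borel" and N: "sets N = sets borel" "prob_space N"
    and [measurable]: "f \<in> borel_measurable borel" "g \<in> borel_measurable borel"
  shows "mutual_energy (distr M borel f) (distr N borel g) = (\<integral>\<^sup>+x. \<integral>\<^sup>+y. neglog \<bar>f x - g y\<bar> \<partial>N \<partial>M)"
proof -
  note [measurable_cong] = M N(1)
  interpret N: prob_space N by fact
  interpret D: prob_space "distr N borel g" by (rule N.prob_space_distr) measurable
  show ?thesis
    unfolding mutual_energy_def by (subst nn_integral_distr; measurable; subst nn_integral_distr; measurable)
qed

lemma prob_measures_on_distr:
  assumes M: "M \<in> prob_measures_on S" and [measurable]: "f \<in> borel_measurable borel"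
    and "f ` S \<subseteq> T" "T \<in> sets borel"
  shows "distr M borel f \<in> prob_measures_on T"
proof (rule prob_measures_onI)
  note [measurable_cong] = prob_measures_onD(1)[OF M]
  interpret prob_space M using prob_measures_onD(2)[OF M] .
  show "prob_space (distr M borel f)" by (rule prob_space_distr) measurable
  have "AE x in M. f x \<in> T"
    using prob_measures_onD(3)[OF M] by eventually_elim (use assms in auto)
  thus "AE x in distr M borel f. x \<in> T"
    using assms by (subst AE_distr_iff) auto
qed (use assms in auto)

text \<open>
  Let \<open>R\<close> be the reflection of \<open>M\<close> and \<open>D\<close> its image under folding. Then \<open>D\<close> has energy
  \<open>J M + J (M, R) \<le> 2 * J M\<close>, while lifting shows that every measure on \<open>S'\<close> has energy
  at least \<open>2 * J M\<close>. So \<open>D\<close> is a minimiser. Applying the lower bound to \<open>D\<close> itself gives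
  \<open>J M \<le> J (M, R)\<close>, which is the case of equality that forces \<open>M\<close> and \<open>R\<close> to have the same moments.
\<close>
theorem energy_minimiser_step:
  assumes min: "energy_minimiser S M"
    and r: "0 \<le> r" "r \<le> 1" and S: "S \<subseteq> {0..r}" "S \<in> sets borel"
    and S': "S' \<subseteq> {0..r\<^sup>2 / 4}" "S' \<in> sets borel"
    and iff: "\<And>x. x \<in> {0..r} \<Longrightarrow> x \<in> S \<longleftrightarrow> x * (r - x) \<in> S'"
  shows "energy_minimiser S' (distr M borel (\<lambda>x. x * (r - x)))"
    and "(\<integral>x. poly p (r - x) \<partial>M) = (\<integral>x. poly p x \<partial>M)"
proof -
  have M: "M \<in> prob_measures_on S" and fin: "mutual_energy M M \<noteq> \<top>"
    and least: "\<And>N. N \<in> prob_measures_on S \<Longrightarrow> mutual_energy M M \<le> mutual_energy N N"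
    using min by (auto simp: energy_minimiser_def)
  note sM [measurable_cong] = prob_measures_onD(1)[OF M]
  interpret M: prob_space M using prob_measures_onD(2)[OF M] .
  have S_unit: "S \<subseteq> {0..1}" using S r by auto
  define R where "R = distr M borel (\<lambda>x. r - x)"
  define D where "D = distr M borel (\<lambda>x. x * (r - x))"
  have M1: "M \<in> prob_measures_on {0..1}" by (rule prob_measures_on_mono[OF M S_unit]) simp
  have R1: "R \<in> prob_measures_on {0..1}"
    unfolding R_def using S r by (intro prob_measures_on_distr[OF M]) auto
  have D: "D \<in> prob_measures_on S'"
    unfolding D_def using S S' iff by (intro prob_measures_on_distr[OF M]) auto
  have RR: "mutual_energy R R = mutual_energy M M"
    unfolding R_def mutual_energy_distr[OF sM sM M.prob_space_axioms]
    by (subst mutual_energy_distr[OF sM sM M.prob_space_axioms])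
       (auto simp: mutual_energy_def abs_minus_commute)
  have MR: "mutual_energy M R = (\<integral>\<^sup>+x. \<integral>\<^sup>+y. neglog \<bar>x - (r - y)\<bar> \<partial>M \<partial>M)"
    unfolding R_def mutual_energy_def
    by (intro nn_integral_cong nn_integral_distr) measurable
  have DD: "mutual_energy D D = mutual_energy M M + mutual_energy M R"
  proof -
    have "mutual_energy D D = (\<integral>\<^sup>+x. \<integral>\<^sup>+y. neglog \<bar>x * (r - x) - y * (r - y)\<bar> \<partial>M \<partial>M)"
      unfolding D_def by (intro mutual_energy_distr sM M.prob_space_axioms) measurable
    also have "\<dots> = (\<integral>\<^sup>+x. \<integral>\<^sup>+y. (neglog \<bar>x - y\<bar> + neglog \<bar>x - (r - y)\<bar>) \<partial>M \<partial>M)"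
    proof (rule nn_integral_cong_AE, use prob_measures_onD(3)[OF M] in eventually_elim)
      case (elim x)
      show ?case
      proof (rule nn_integral_cong_AE, use prob_measures_onD(3)[OF M] in eventually_elim)
        case (elim y)
        have "x \<in> {0..r}" "y \<in> {0..r}" using \<open>x \<in> S\<close> elim S by auto
        moreover have "x * (r - x) - y * (r - y) = - ((x - y) * (x - (r - y)))"
          by (simp add: algebra_simps)
        hence "\<bar>x * (r - x) - y * (r - y)\<bar> = \<bar>x - y\<bar> * \<bar>x - (r - y)\<bar>"
          by (simp only: abs_mult abs_minus_cancel)
        ultimately show ?case using r by (auto intro!: neglog_mult)
      qed
    qed
    also have "\<dots> = mutual_energy M M + mutual_energy M R"
      unfolding MR unfolding mutual_energy_def by (simp add: nn_integral_add)
    finally show ?thesis .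
  qed
  have DM: "mutual_energy D D \<le> 2 * mutual_energy M M"
  proof -
    have "2 * mutual_energy M R \<le> 2 * mutual_energy M M"
      using mutual_energy_le[OF M1 R1] by (simp add: RR mult_2)
    hence "mutual_energy M R \<le> mutual_energy M M"
      by (subst (asm) ennreal_mult_le_mult_iff) auto
    thus ?thesis unfolding DD mult_2 by (rule add_left_mono)
  qed
  have below: "2 * mutual_energy M M \<le> mutual_energy N N" if N: "N \<in> prob_measures_on S'" for N
  proof -
    have "symmetric_lift r N \<in> prob_measures_on S"
      using preimage_branch[of _ r] S' iff r by (intro symmetric_lift_on[OF N S(2)]) force
    from least[OF this] mutual_energy_symmetric_lift[OF prob_measures_on_mono[OF N S'(1)] r]
    show ?thesis by (metis mult_left_mono zero_le borel_closed closed_atLeastAtMost)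
  qed
  show "energy_minimiser S' (distr M borel (\<lambda>x. x * (r - x)))"
    unfolding D_def[symmetric] energy_minimiser_def
  proof (intro conjI ballI D)
    show "mutual_energy D D \<noteq> \<top>"
      using DM fin by (auto simp: top_unique ennreal_mult_eq_top_iff)
    show "mutual_energy D D \<le> mutual_energy N N" if "N \<in> prob_measures_on S'" for N
      using DM below[OF that] by (rule order_trans)
  qed
  have "mutual_energy M M + mutual_energy R R \<le> 2 * mutual_energy M R"
  proof -
    have "mutual_energy M M + mutual_energy M M \<le> mutual_energy M M + mutual_energy M R"
      using below[OF D] unfolding DD mult_2 .
    hence "mutual_energy M M \<le> mutual_energy M R"
      using fin by (simp add: ennreal_add_left_cancel_le)
    thus ?thesis unfolding RR mult_2 by (intro add_mono)
  qed
  hence "(\<integral>x. x ^ m \<partial>M) = (\<integral>x. x ^ m \<partial>R)" for m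
    using fin by (intro moments_eq M1 R1) (auto simp: RR)
  hence "(\<integral>x. poly p x \<partial>M) = (\<integral>x. poly p x \<partial>R)"
    by (intro integral_poly_eq M1 R1)
  thus "(\<integral>x. poly p (r - x) \<partial>M) = (\<integral>x. poly p x \<partial>M)"
    unfolding R_def
    by (subst (asm) integral_distr) (auto intro!: borel_measurable_continuous_onI continuous_intros)
qed

section \<open>Three-term recurrences and even subfamilies\<close>

text \<open>The monic polynomials \<open>q\<close> with \<open>q (n + 1) = (x - b n) q n - A n q (n - 1)\<close>. In contrast to the
  usual numbering of Jacobi parameters, \<open>b\<close> starts at index \<open>0\<close>; \<open>A n\<close> stands for \<open>a n\<close> squared.\<close>
fun recurrence_poly :: "(nat \<Rightarrow> real) \<Rightarrow> (nat \<Rightarrow> real) \<Rightarrow> nat \<Rightarrow> real poly" where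
  "recurrence_poly A b 0 = 1"
| "recurrence_poly A b (Suc 0) = [:- b 0, 1:]"
| "recurrence_poly A b (Suc (Suc n)) =
     [:- b (Suc n), 1:] * recurrence_poly A b (Suc n) - smult (A (Suc n)) (recurrence_poly A b n)"

text \<open>With \<open>A 0 = 0\<close> the recurrence has a uniform shape: for \<open>n = 0\<close> the last term vanishes, whatever
  the truncated index \<open>n - 1\<close> refers to.\<close>
lemma recurrence_poly_Suc:
  "A 0 = 0 \<Longrightarrow> recurrence_poly A b (Suc n) =
     [:- b n, 1:] * recurrence_poly A b n - smult (A n) (recurrence_poly A b (n - 1))"
  by (cases n) auto

lemma recurrence_poly_monic:
  "degree (recurrence_poly A b n) = n \<and> lead_coeff (recurrence_poly A b n) = 1"
proof (induction A b n rule: recurrence_poly.induct)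
  case (3 A b n)
  let ?p = "[:- b (Suc n), 1:] * recurrence_poly A b (Suc n)"
  let ?s = "smult (A (Suc n)) (recurrence_poly A b n)"
  have p: "degree ?p = Suc (Suc n)" "lead_coeff ?p = 1"
  proof -
    have "recurrence_poly A b (Suc n) \<noteq> 0" using 3 by auto
    thus "degree ?p = Suc (Suc n)" using 3 by (subst degree_mult_eq) auto
    show "lead_coeff ?p = 1" unfolding lead_coeff_mult using 3 by auto
  qed
  have s: "degree ?s < degree ?p"
    unfolding p(1) using 3 by (intro le_less_trans[OF degree_smult_le]) auto
  have "degree (?p - ?s) = Suc (Suc n)"
    using degree_add_eq_left[of "- ?s" ?p] s p(1) by simp
  moreover have "coeff (?p - ?s) (Suc (Suc n)) = 1"
    using p s coeff_eq_0[of ?s "Suc (Suc n)"] by (simp del: mult_pCons_left)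
  ultimately show ?case by (simp del: mult_pCons_left)
qed auto

text \<open>Orthogonality involves a measure only through its integrals of polynomials, so the algebra is
  done for a normalised linear functional on polynomials.\<close>
locale moment_functional =
  fixes L :: "real poly \<Rightarrow> real"
  assumes L_add: "L (p + q) = L p + L q"
    and L_smult: "L (smult c p) = c * L p"
    and L_one: "L 1 = 1"
begin

lemma L_diff: "L (p - q) = L p - L q"
  using L_add[of "p - q" q] by simp

end

locale jacobi_functional = moment_functional +
  fixes A b :: "nat \<Rightarrow> real"
  assumes A_0: "A 0 = 0"
    and A_pos: "n \<ge> 1 \<Longrightarrow> A n > 0"
    and orth: "degree p < n \<Longrightarrow> L (recurrence_poly A b n * p) = 0"
begin

abbreviation q :: "nat \<Rightarrow> real poly" where "q \<equiv> recurrence_poly A b"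

lemmas q_Suc = recurrence_poly_Suc[where A = A, OF A_0]

lemma degree_q [simp]: "degree (q n) = n"
  and coeff_q [simp]: "coeff (q n) n = 1"
  using recurrence_poly_monic[of A b n] by auto

lemma orth_q: "m \<noteq> n \<Longrightarrow> L (q m * q n) = 0"
  using orth[of "q n" m] orth[of "q m" n] by (cases "n < m") (auto simp: mult.commute)

text \<open>Evaluating \<open>x q (n + 1) q n\<close> with the recurrence for \<open>q (n + 2)\<close> and with that for \<open>q (n + 1)\<close>
  shows that the squared norm of \<open>q (n + 1)\<close> is \<open>A (n + 1)\<close> times that of \<open>q n\<close>.\<close>
lemma norm_pos: "L (q n * q n) > 0"
proof (induction n)
  case 0
  show ?case using L_one by simp
next
  case (Suc n)
  have *: "[:- b (Suc n), 1:] * q (Suc n) * q n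
      = q (Suc (Suc n)) * q n + smult (A (Suc n)) (q n * q n)"
    by (simp add: algebra_simps)
  have "[:- b (Suc n), 1:] * q (Suc n) * q n
      = q (Suc n) * q (Suc n) + smult (b n - b (Suc n)) (q (Suc n) * q n)
        + smult (A n) (q (Suc n) * q (n - 1))"
  proof -
    have "[:- b (Suc n), 1:] = [:- b n, 1:] + [:b n - b (Suc n):]" by simp
    hence "[:- b (Suc n), 1:] * q (Suc n) * q n
      = q (Suc n) * ([:- b n, 1:] * q n) + [:b n - b (Suc n):] * (q (Suc n) * q n)"
      by (simp only: algebra_simps)
    moreover have "[:- b n, 1:] * q n = q (Suc n) + smult (A n) (q (n - 1))"
      using q_Suc[of b n] by simp
    moreover have "[:c:] * p = smult c p" for c :: real and p by simp
    ultimately show ?thesis by (simp only: distrib_left mult_smult_right add_ac)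
  qed
  hence "L ([:- b (Suc n), 1:] * q (Suc n) * q n) = L (q (Suc n) * q (Suc n))"
    using orth_q[of "Suc n" n] orth_q[of "Suc n" "n - 1"]
    by (simp add: L_add L_smult del: mult_pCons_left recurrence_poly.simps)
  moreover have "L ([:- b (Suc n), 1:] * q (Suc n) * q n) = A (Suc n) * L (q n * q n)"
    unfolding * using orth_q[of "Suc (Suc n)" n]
    by (simp add: L_add L_smult del: mult_pCons_left recurrence_poly.simps)
  ultimately show ?case using Suc A_pos[of "Suc n"] by simp
qed

text \<open>If \<open>b\<close> equals \<open>r / 2\<close> below \<open>n\<close>, the recurrence makes \<open>q n\<close> even or odd about \<open>r / 2\<close>, so
  \<open>(x - r / 2) (q n)\<^sup>2\<close> is odd and has integral \<open>0\<close>. Orthogonality says that \<open>(x - b n) (q n)\<^sup>2\<close> also has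
  integral \<open>0\<close>, and the norm of \<open>q n\<close> is positive.\<close>
lemma symmetric_imp_b_const:
  assumes sym: "\<And>p. L (pcompose p [:r, -1:]) = L p"
  shows "b n = r / 2"
proof -
  have "b n = r / 2 \<and> pcompose (q n) [:r, -1:] = smult ((-1) ^ n) (q n)" for n
  proof (induction n rule: less_induct)
    case (less n)
    have refl: "pcompose (q n) [:r, -1:] = smult ((-1) ^ n) (q n)"
    proof (cases n)
      case (Suc m)
      have bm: "b m = r / 2" and qm: "pcompose (q m) [:r, -1:] = smult ((-1) ^ m) (q m)"
        using less[of m] Suc by auto
      have "smult (A m) (pcompose (q (m - 1)) [:r, -1:]) = smult (A m) (smult ((-1) ^ n) (q (m - 1)))"
        using less[of "m - 1"] Suc A_0 by (cases m) auto
      moreover define X where "X = [:- b m, 1:]"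
      moreover have "pcompose X [:r, -1:] = - X"
        using bm by (simp add: pcompose_pCons X_def)
      ultimately show ?thesis
        unfolding Suc q_Suc[of b m] pcompose_diff pcompose_mult pcompose_smult qm X_def[symmetric]
        by (simp add: Suc smult_diff_right mult.commute)
    qed (simp add: pcompose_1)
    have "L ([:- b n, 1:] * (q n * q n)) = 0"
    proof -
      have "[:- b n, 1:] * (q n * q n) = q (Suc n) * q n + smult (A n) (q n * q (n - 1))"
        unfolding q_Suc[of b n] by (simp add: algebra_simps del: mult_pCons_left)
      moreover have "A n * L (q n * q (n - 1)) = 0"
        using orth_q[of n "n - 1"] A_0 by (cases n) auto
      ultimately show ?thesis using orth_q[of "Suc n" n]
        by (simp add: L_add L_smult del: mult_pCons_left recurrence_poly.simps)
    qed
    moreover have "L ([:- r / 2, 1:] * (q n * q n)) = 0"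
    proof -
      have "pcompose ([:- r / 2, 1:] * (q n * q n)) [:r, -1:] = smult (-1) ([:- r / 2, 1:] * (q n * q n))"
      proof -
        have neg: "pcompose (X * (q n * q n)) [:r, -1:] = smult (-1) (X * (q n * q n))"
          if "pcompose X [:r, -1:] = - X" for X
          unfolding pcompose_mult refl that by (simp flip: power_mult_distrib)
        show ?thesis by (rule neg) (simp add: pcompose_pCons)
      qed
      hence "L ([:- r / 2, 1:] * (q n * q n)) = - L ([:- r / 2, 1:] * (q n * q n))"
        using sym[of "[:- r / 2, 1:] * (q n * q n)"] by (simp only: L_smult)
      thus ?thesis by linarith
    qed
    moreover have "[:- b n, 1:] * (q n * q n) - [:- r / 2, 1:] * (q n * q n) = smult (r / 2 - b n) (q n * q n)"
      by (simp add: smult_diff_left flip: left_diff_distrib)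
    ultimately have "(r / 2 - b n) * L (q n * q n) = 0"
      by (metis L_diff L_smult diff_zero)
    thus ?case using norm_pos[of n] refl by simp
  qed
  thus ?thesis by blast
qed

end

locale symmetric_jacobi_functional = jacobi_functional L A "\<lambda>_. r / 2" for L A and r :: real
begin

text \<open>The recurrence coefficients after folding. For \<open>n = 0\<close> the truncated index \<open>2 * n - 1\<close> is \<open>0\<close>, so
  \<open>A' 0 = 0\<close> follows from \<open>A 0 = 0\<close>.\<close>
abbreviation A' where "A' \<equiv> \<lambda>n. A (2 * n) * A (2 * n - 1)"
abbreviation b' where "b' \<equiv> \<lambda>n. r\<^sup>2 / 4 - A (2 * n) - A (2 * n + 1)"

text \<open>Two steps of the recurrence, with \<open>q (2 n - 1)\<close> eliminated, relate three consecutive polynomials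
  of even degree; here \<open>(x - r / 2)\<^sup>2 = r\<^sup>2 / 4 - x (r - x)\<close>.\<close>
lemma even_q_Suc:
  "q (2 * Suc n) = (- [:0, r, -1:] + [:b' n:]) * q (2 * n)
      - smult (A' n) (q (2 * (n - 1)))"
proof -
  let ?X = "[:- (r / 2), 1:]"
  have s: "q (Suc m) = ?X * q m - smult (A m) (q (m - 1))" for m
    using q_Suc[of "\<lambda>_. r / 2" m] .
  have 1: "q (2 * Suc n) = ?X * q (2 * n + 1) - smult (A (2 * n + 1)) (q (2 * n))"
    using s[of "2 * n + 1"] by (simp del: recurrence_poly.simps mult_pCons_left)
  have 2: "q (2 * n + 1) = ?X * q (2 * n) - smult (A (2 * n)) (q (2 * n - 1))"
    using s[of "2 * n"] by (simp del: recurrence_poly.simps mult_pCons_left)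
  have 3: "smult (A (2 * n)) (?X * q (2 * n - 1))
      = smult (A (2 * n)) (q (2 * n)) + smult (A' n) (q (2 * (n - 1)))"
  proof (cases n)
    case (Suc k)
    have "?X * q (2 * n - 1) = q (2 * n) + smult (A (2 * n - 1)) (q (2 * n - 2))"
      using s[of "2 * n - 1"] Suc by (simp del: recurrence_poly.simps mult_pCons_left)
    thus ?thesis by (simp only: smult_add_right smult_smult right_diff_distrib') simp
  qed (simp add: A_0)
  have 4: "?X * ?X = - [:0, r, -1:] + [:r\<^sup>2 / 4:]"
    by (simp add: power2_eq_square)
  have "q (2 * Suc n) = ?X * ?X * q (2 * n) - smult (A (2 * n)) (?X * q (2 * n - 1))
      - smult (A (2 * n + 1)) (q (2 * n))"
    unfolding 1 2 by (simp only: algebra_simps mult_smult_right)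
  also have "\<dots> = (- [:0, r, -1:] + [:r\<^sup>2 / 4:]) * q (2 * n) - [:A (2 * n):] * q (2 * n)
      - smult (A' n) (q (2 * (n - 1))) - [:A (2 * n + 1):] * q (2 * n)"
    unfolding 3 4 by (simp add: algebra_simps)
  also have "\<dots> = (- [:0, r, -1:] + [:r\<^sup>2 / 4:] - [:A (2 * n):] - [:A (2 * n + 1):]) * q (2 * n)
      - smult (A' n) (q (2 * (n - 1)))"
    by (simp only: algebra_simps)
  also have "- [:0, r, -1:] + [:r\<^sup>2 / 4:] - [:A (2 * n):] - [:A (2 * n + 1):]
      = - [:0, r, -1:] + [:b' n:]" by simp
  finally show ?thesis .
qed

text \<open>The sign compensates for the leading coefficient \<open>-1\<close> of \<open>x (r - x)\<close>.\<close>
lemma even_q: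
  "q (2 * n) = smult ((-1) ^ n) (pcompose (recurrence_poly A' b' n) [:0, r, -1:])"
proof (induction n rule: less_induct)
  case (less n)
  show ?case
  proof (cases n)
    case (Suc m)
    have A'0: "A' 0 = 0" using A_0 by simp
    let ?W = "[:0, r, -1:]" and ?q' = "recurrence_poly A' b'"
    have m: "q (2 * m) = smult ((-1) ^ m) (pcompose (?q' m) ?W)"
      using less[of m] Suc by simp
    have k: "smult (A' m) (q (2 * (m - 1)))
        = smult (A' m) (smult ((-1) ^ n) (pcompose (?q' (m - 1)) ?W))"
      using less[of "m - 1"] Suc A_0 by (cases m) auto
    define Y where "Y = - ?W + [:b' m:]"
    have Y: "pcompose [:- b' m, 1:] ?W = - Y"
      by (simp add: pcompose_pCons Y_def)
    show ?thesis
      unfolding Suc even_q_Suc k recurrence_poly_Suc[where A = A', OF A'0] pcompose_diff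
        pcompose_mult pcompose_smult Y Y_def[symmetric] m
      by (simp add: Suc smult_diff_right mult.commute)
  qed (simp add: pcompose_1)
qed

text \<open>The functional is the push-forward under folding. A polynomial of degree less than \<open>n\<close> in
  \<open>x (r - x)\<close> has degree less than \<open>2 n\<close> in \<open>x\<close>, so orthogonality is inherited from \<open>q (2 n)\<close>.\<close>
theorem even_jacobi_functional:
  "jacobi_functional (\<lambda>p. L (pcompose p [:0, r, -1:])) A' b'"
proof
  show "L (pcompose (p + q) [:0, r, -1:]) = L (pcompose p [:0, r, -1:]) + L (pcompose q [:0, r, -1:])" for p q
    by (simp add: pcompose_add L_add)
  show "L (pcompose (smult c p) [:0, r, -1:]) = c * L (pcompose p [:0, r, -1:])" for c p
    by (simp add: pcompose_smult L_smult)
  show "L (pcompose 1 [:0, r, -1:]) = 1"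
    by (simp add: L_one pcompose_1)
  show "A' 0 = 0" by (simp add: A_0)
  show "A' n > 0" if "n \<ge> 1" for n
    using that A_pos[of "2 * n"] A_pos[of "2 * n - 1"] by simp
  show "L (pcompose (recurrence_poly A' b' n * p) [:0, r, -1:]) = 0" if "degree p < n" for p n
  proof -
    have "pcompose (recurrence_poly A' b' n) [:0, r, -1:] = smult ((-1) ^ n) (q (2 * n))"
      unfolding even_q by (simp flip: power_mult_distrib)
    moreover have "degree (pcompose p [:0, r, -1:]) < 2 * n"
      using that by (simp add: degree_pcompose)
    ultimately show ?thesis
      using orth[of "pcompose p [:0, r, -1:]" "2 * n"] by (simp add: pcompose_mult L_smult)
  qed
qed

end

section \<open>The renormalised recursion\<close>

text \<open>
  The constant \<open>1 / 12\<close> is the double root of \<open>x (1 / 6 - x) = 1 / 144\<close>: for \<open>\<gamma> = 1 / 6\<close> the row sums are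
  \<open>1 / 6\<close> and the products at most \<open>1 / 36 * 1 / 4 = 1 / 144\<close>, so an even entry at most \<open>1 / 12\<close> forces the
  next odd one to be at least \<open>1 / 12\<close>, and that one bounds the next even entry by \<open>1 / 12\<close>. The limit is
  shown by induction on \<open>n\<close> for all \<open>t\<close> at once: odd indices reduce to the preceding even one by
  the sum rule, and an even index \<open>2 m\<close> reduces by the product rule to \<open>2 m - 1\<close> and to the index \<open>m\<close>
  of row \<open>t + 1\<close>.
\<close>
lemma renormalised_limit:
  fixes \<alpha> :: "nat \<Rightarrow> nat \<Rightarrow> real" and \<gamma> :: "nat \<Rightarrow> real"
  assumes \<gamma>: "\<And>t. 0 < \<gamma> t \<and> \<gamma> t \<le> 1 / 6"
    and zero: "\<And>t. \<alpha> t 0 = 0"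
    and pos: "\<And>t n. n \<ge> 1 \<Longrightarrow> \<alpha> t n > 0"
    and add: "\<And>t n. \<alpha> t (2 * n) + \<alpha> t (2 * n + 1) = 1 / 4 - \<gamma> t / 2"
    and mult: "\<And>t n. \<alpha> t (2 * n) * \<alpha> t (2 * n - 1) = (\<gamma> t)\<^sup>2 * \<alpha> (Suc t) n"
  shows "(\<lambda>s. \<alpha> t (j * 2 ^ s + n)) \<longlonglongrightarrow> \<alpha> t n"
proof -
  have nonneg: "\<alpha> t n \<ge> 0" for t n
    using pos[of n t] zero[of t] by (cases n) auto
  have \<gamma>2: "(\<gamma> t)\<^sup>2 \<le> 1 / 36" for t
    using power_mono[of "\<gamma> t" "1 / 6" 2] \<gamma>[of t] by (simp add: power2_eq_square)
  have bound: "\<alpha> t n \<le> 1 / 4" for t n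
  proof (cases "even n")
    case True
    then show ?thesis using add[of t "n div 2"] nonneg[of t "n + 1"] \<gamma>[of t] by simp
  next
    case False
    then show ?thesis using add[of t "n div 2"] nonneg[of t "n - 1"] \<gamma>[of t]
      by (auto elim!: oddE)
  qed
  have even_le: "\<alpha> t (2 * n) \<le> 1 / 12" for t n
  proof (induction n)
    case (Suc n)
    have odd: "\<alpha> t (2 * n + 1) \<ge> 1 / 12"
      using add[of t n] Suc \<gamma>[of t] by linarith
    have "(\<gamma> t)\<^sup>2 * \<alpha> (Suc t) (Suc n) \<le> 1 / 36 * (1 / 4)"
      by (intro mult_mono \<gamma>2 bound nonneg) auto
    hence "\<alpha> t (2 * Suc n) * \<alpha> t (2 * n + 1) \<le> 1 / 12 * (1 / 12)"
      using mult[of t "Suc n"] by simp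
    also have "\<dots> \<le> 1 / 12 * \<alpha> t (2 * n + 1)"
      using odd by simp
    finally show ?case
      using odd by (simp add: mult_le_cancel_right)
  qed (simp add: zero)
  have odd_ge: "\<alpha> t (2 * n + 1) \<ge> 1 / 12" for t n
    using add[of t n] even_le[of t n] \<gamma>[of t] by linarith
  have contract: "\<alpha> t (2 * n) \<le> \<alpha> (Suc t) n / 3" for t n
  proof (cases n)
    case (Suc m)
    have "\<alpha> t (2 * n) / 12 \<le> \<alpha> t (2 * n) * \<alpha> t (2 * n - 1)"
      using mult_left_mono[OF odd_ge[of t m] nonneg[of t "2 * n"]] Suc by simp
    also have "\<dots> \<le> 1 / 36 * \<alpha> (Suc t) n"
      unfolding mult by (intro mult_right_mono \<gamma>2 nonneg)
    finally show ?thesis by simp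
  qed (simp add: zero)
  have geometric: "\<alpha> t (j * 2 ^ s) \<le> 1 / 4 * (1 / 3) ^ s" for s t
  proof (induction s arbitrary: t)
    case (Suc s)
    have "\<alpha> t (j * 2 ^ Suc s) \<le> \<alpha> (Suc t) (j * 2 ^ s) / 3"
      using contract[of t "j * 2 ^ s"] by (simp add: mult.left_commute)
    with Suc[of "Suc t"] show ?case by simp
  qed (use bound in simp)
  show ?thesis
  proof (induction n arbitrary: t rule: less_induct)
    case (less n)
    consider "n = 0" | m where "n = 2 * m + 1" | m where "n = 2 * Suc m"
      by atomize_elim presburger
    thus ?case
    proof cases
      case 1
      have "(\<lambda>s. 1 / 4 * (1 / 3) ^ s :: real) \<longlonglongrightarrow> 1 / 4 * (0 :: real)"
        by (intro tendsto_mult tendsto_const LIMSEQ_power_zero) simp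
      hence "(\<lambda>s. \<alpha> t (j * 2 ^ s)) \<longlonglongrightarrow> 1 / 4 * 0"
        by (rule tendsto_sandwich[OF _ _ tendsto_const, rotated 2])
           (simp_all add: nonneg geometric[simplified])
      thus ?thesis using 1 zero by simp
    next
      case (2 m)
      have "(\<lambda>s. \<alpha> t (j * 2 ^ Suc s + 2 * m)) \<longlonglongrightarrow> \<alpha> t (2 * m)"
        using LIMSEQ_Suc[OF less[of "2 * m" t]] 2 by simp
      hence "(\<lambda>s. 1 / 4 - \<gamma> t / 2 - \<alpha> t (j * 2 ^ Suc s + 2 * m)) \<longlonglongrightarrow> 1 / 4 - \<gamma> t / 2 - \<alpha> t (2 * m)"
        by (intro tendsto_diff tendsto_const)
      moreover have "1 / 4 - \<gamma> t / 2 - \<alpha> t (j * 2 ^ Suc s + 2 * m) = \<alpha> t (j * 2 ^ Suc s + n)" for s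
        using add[of t "j * 2 ^ s + m"] 2 by (simp add: algebra_simps)
      moreover have "1 / 4 - \<gamma> t / 2 - \<alpha> t (2 * m) = \<alpha> t n"
        using add[of t m] 2 by simp
      ultimately show ?thesis
        using LIMSEQ_imp_Suc[of "\<lambda>s. \<alpha> t (j * 2 ^ s + n)"] by simp
    next
      case (3 m)
      have ratio: "(\<gamma> t)\<^sup>2 * \<alpha> (Suc t) (Suc k) / \<alpha> t (2 * k + 1) = \<alpha> t (2 * Suc k)" for k
        using mult[of t "Suc k"] pos[of "2 * k + 1" t] by (simp add: field_simps)
      have "(\<lambda>s. \<alpha> t (j * 2 ^ Suc s + (2 * m + 1))) \<longlonglongrightarrow> \<alpha> t (2 * m + 1)"
        using LIMSEQ_Suc[OF less[of "2 * m + 1" t]] 3 by simp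
      hence "(\<lambda>s. (\<gamma> t)\<^sup>2 * \<alpha> (Suc t) (j * 2 ^ s + Suc m) / \<alpha> t (j * 2 ^ Suc s + (2 * m + 1)))
          \<longlonglongrightarrow> (\<gamma> t)\<^sup>2 * \<alpha> (Suc t) (Suc m) / \<alpha> t (2 * m + 1)"
        using less[of "Suc m" "Suc t"] 3 pos[of "2 * m + 1" t]
        by (intro tendsto_divide tendsto_mult tendsto_const) auto
      moreover have "(\<gamma> t)\<^sup>2 * \<alpha> (Suc t) (j * 2 ^ s + Suc m) / \<alpha> t (j * 2 ^ Suc s + (2 * m + 1))
          = \<alpha> t (j * 2 ^ Suc s + n)" for s
        using ratio[of "j * 2 ^ s + m"] 3 by (simp add: algebra_simps)
      ultimately show ?thesis
        using LIMSEQ_imp_Suc[of "\<lambda>s. \<alpha> t (j * 2 ^ s + n)"] 3 ratio[of m] by simp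
    qed
  qed
qed

section \<open>The Cantor set and its equilibrium measure\<close>

text \<open>The orbit of a point of stage \<open>s\<close> under \<open>k\<close> successive folding maps, the innermost one being that
  of stage \<open>s\<close>.\<close>
fun orbit :: "(nat \<Rightarrow> real) \<Rightarrow> nat \<Rightarrow> nat \<Rightarrow> real \<Rightarrow> real" where
  "orbit r s 0 x = x"
| "orbit r s (Suc k) x = orbit r (Suc s) k (x * (r s - x))"

definition level_set :: "(nat \<Rightarrow> real) \<Rightarrow> nat \<Rightarrow> real set" where
  "level_set r s = {x. \<forall>k. 0 \<le> orbit r s k x}"

lemma orbit_Suc: "orbit r s (Suc k) x = orbit r s k x * (r (s + k) - orbit r s k x)"
  by (induction k arbitrary: s x) auto

lemma level_set_iff: "x \<in> level_set r s \<longleftrightarrow> 0 \<le> x \<and> x * (r s - x) \<in> level_set r (Suc s)"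
  unfolding level_set_def mem_Collect_eq
proof safe
  assume *: "\<forall>k. 0 \<le> orbit r s k x"
  show "0 \<le> x" using *[rule_format, of 0] by simp
  show "0 \<le> orbit r (Suc s) k (x * (r s - x))" for k using *[rule_format, of "Suc k"] by simp
next
  fix k assume "0 \<le> x" "\<forall>k. 0 \<le> orbit r (Suc s) k (x * (r s - x))"
  thus "0 \<le> orbit r s k x" by (cases k) simp_all
qed

lemma level_set_le:
  assumes "0 \<le> r s"
  shows "level_set r s \<subseteq> {0..r s}"
proof
  fix x assume "x \<in> level_set r s"
  hence "0 \<le> orbit r s 0 x" "0 \<le> orbit r s (Suc 0) x"
    unfolding level_set_def by blast+
  hence "0 \<le> x" "0 \<le> x * (r s - x)" by simp_all
  thus "x \<in> {0..r s}" using assms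
    by (cases "x = 0") (auto simp: zero_le_mult_iff)
qed

lemma level_set_borel [measurable]: "level_set r s \<in> sets borel"
proof -
  have "continuous_on UNIV (orbit r s k)" for k s
  proof (induction k arbitrary: s)
    case (Suc k)
    have "continuous_on UNIV (\<lambda>x. orbit r (Suc s) k (x * (r s - x)))"
      by (rule continuous_on_compose2[OF Suc]) (auto intro!: continuous_intros)
    thus ?case by simp
  qed simp
  hence "closed {x. 0 \<le> orbit r s k x}" for k
    by (intro closed_Collect_le continuous_on_const) 
  hence "closed (\<Inter>k. {x. 0 \<le> orbit r s k x})" by blast
  moreover have "level_set r s = (\<Inter>k. {x. 0 \<le> orbit r s k x})"
    by (auto simp: level_set_def)
  ultimately show ?thesis by simp
qed

lemma poly_P2_Suc: "poly (P2 \<gamma> (Suc s)) x = - orbit (cantor_r \<gamma>) 0 (Suc s) x"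
proof (induction s)
  case 0
  show ?case by (simp add: algebra_simps)
next
  case (Suc s)
  have "poly (P2 \<gamma> (Suc (Suc s))) x
      = poly (P2 \<gamma> (Suc s)) x * (poly (P2 \<gamma> (Suc s)) x + cantor_r \<gamma> (Suc s))"
    by (simp only: P2.simps(2)[of \<gamma> "Suc s"]) simp
  thus ?case unfolding Suc orbit_Suc[of _ _ "Suc s"] by (simp add: algebra_simps)
qed

lemma cantor_K_eq_level_set: "cantor_K \<gamma> = level_set (cantor_r \<gamma>) 0"
proof -
  let ?o = "orbit (cantor_r \<gamma>) 0"
  have K: "x \<in> cantor_K \<gamma> \<longleftrightarrow> (\<forall>k. 0 \<le> ?o (Suc k) x)" for x
    by (simp add: cantor_K_def cantor_E_def poly_P2_Suc del: P2.simps orbit.simps)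
  have "0 \<le> ?o k x" if "\<forall>k. 0 \<le> ?o (Suc k) x" for x k
  proof (cases k)
    case 0
    have "0 \<le> ?o (Suc 0) x" using that by blast
    thus ?thesis using 0 by (auto simp: zero_le_mult_iff)
  qed (use that in blast)
  thus ?thesis unfolding level_set_def using K by blast
qed

text \<open>On \<open>[0, 1]\<close> the negative part of the kernel vanishes, so \<^const>\<open>log_energy\<close> is the nonnegative energy;
  positive capacity makes the minimal energy finite.\<close>
lemma equilibrium_measure_minimises:
  assumes eq: "is_equilibrium_measure S \<mu>" and S: "S \<subseteq> {0..1}" and cap: "log_capacity S > 0"
  shows "energy_minimiser S \<mu>"
proof -
  have energy: "log_energy N = enn2ereal (mutual_energy N N)" if N: "N \<in> prob_measures_on S" for N
  proof -
    have 0: "e2ennreal (- log_kernel x y) = 0" if "x \<in> S" "y \<in> S" for x y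
    proof -
      have "ln (1 / \<bar>x - y\<bar>) \<ge> 0" if "x \<noteq> y"
      proof -
        have "x \<in> {0..1}" "y \<in> {0..1}" using S \<open>x \<in> S\<close> \<open>y \<in> S\<close> by auto
        hence "\<bar>x - y\<bar> \<le> 1" by auto
        thus ?thesis using that by (intro ln_ge_zero) (simp add: le_divide_eq_1_pos)
      qed
      thus ?thesis by (auto simp: log_kernel_def e2ennreal_neg)
    qed
    have "(\<integral>\<^sup>+x. \<integral>\<^sup>+y. e2ennreal (- log_kernel x y) \<partial>N \<partial>N) = (\<integral>\<^sup>+x. \<integral>\<^sup>+y. 0 \<partial>N \<partial>N)"
      by (rule nn_integral_cong_AE, use prob_measures_onD(3)[OF N] in eventually_elim,
          rule nn_integral_cong_AE, use prob_measures_onD(3)[OF N] in eventually_elim) (rule 0)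
    thus ?thesis
      by (simp add: log_energy_def e2ennreal_log_kernel mutual_energy_def zero_ennreal.rep_eq)
  qed
  have \<mu>: "\<mu> \<in> prob_measures_on S" using eq by (simp add: is_equilibrium_measure_def)
  have least: "log_energy \<mu> \<le> log_energy N" if "N \<in> prob_measures_on S" for N
    using eq that by (simp add: is_equilibrium_measure_def)
  have "mutual_energy \<mu> \<mu> \<noteq> \<top>"
  proof
    assume "mutual_energy \<mu> \<mu> = \<top>"
    hence "log_energy \<mu> = \<infinity>" using energy[OF \<mu>] by (simp add: top_ennreal.rep_eq top_ereal_def)
    hence "\<infinity> \<le> robin_constant S"
      unfolding robin_constant_def using least by (metis INF_greatest)
    thus False using cap by (simp add: log_capacity_def)
  qed
  moreover have "mutual_energy \<mu> \<mu> \<le> mutual_energy N N" if "N \<in> prob_measures_on S" for N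
    using least[OF that] unfolding energy[OF \<mu>] energy[OF that] less_eq_ennreal.rep_eq .
  ultimately show ?thesis
    unfolding energy_minimiser_def using \<mu> by blast
qed

lemma cantor_r_pos:
  assumes "\<forall>s\<ge>1. 0 < \<gamma> s \<and> \<gamma> s < 1 / 4"
  shows "0 < cantor_r \<gamma> s"
proof (induction s)
  case (Suc s)
  have "0 < \<gamma> (Suc s)" using assms by simp
  with Suc show ?case by simp
qed simp

lemma cantor_r_Suc_le:
  assumes "\<forall>s\<ge>1. 0 < \<gamma> s \<and> \<gamma> s < 1 / 4"
  shows "cantor_r \<gamma> (Suc s) \<le> (cantor_r \<gamma> s)\<^sup>2 / 4"
proof -
  have "\<gamma> (Suc s) \<le> 1 / 4" using assms by (simp add: less_imp_le)
  from mult_right_mono[OF this, of "(cantor_r \<gamma> s)\<^sup>2"] show ?thesis by simp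
qed

lemma cantor_r_le_1:
  assumes "\<forall>s\<ge>1. 0 < \<gamma> s \<and> \<gamma> s < 1 / 4"
  shows "cantor_r \<gamma> s \<le> 1"
proof (induction s)
  case (Suc s)
  have "(cantor_r \<gamma> s)\<^sup>2 \<le> 1"
    using Suc cantor_r_pos[OF assms, of s] by (intro power_le_one) auto
  thus ?case using cantor_r_Suc_le[OF assms, of s] by linarith
qed simp

primrec pushed_measure :: "real measure \<Rightarrow> (nat \<Rightarrow> real) \<Rightarrow> nat \<Rightarrow> real measure" where
  "pushed_measure M r 0 = M"
| "pushed_measure M r (Suc s) = distr (pushed_measure M r s) borel (\<lambda>x. x * (r s - x))"

text \<open>The minimality and the reflection symmetry pass from each stage to the next. The condition
  \<open>\<gamma> (s + 1) < 1 / 4\<close> puts stage \<open>s + 1\<close> into \<open>[0, (r s)\<^sup>2 / 4]\<close>, the image of \<open>[0, r s]\<close> under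
  the folding map of stage \<open>s\<close>.\<close>
lemma pushed_measure_minimises:
  assumes \<gamma>: "\<forall>s\<ge>1. 0 < \<gamma> s \<and> \<gamma> s < 1 / 4"
    and min: "energy_minimiser (level_set (cantor_r \<gamma>) 0) M"
  shows "energy_minimiser (level_set (cantor_r \<gamma>) s) (pushed_measure M (cantor_r \<gamma>) s)"
    and "(\<integral>x. poly p (cantor_r \<gamma> s - x) \<partial>pushed_measure M (cantor_r \<gamma>) s)
       = (\<integral>x. poly p x \<partial>pushed_measure M (cantor_r \<gamma>) s)"
proof -
  note r = cantor_r_pos[OF \<gamma>] cantor_r_le_1[OF \<gamma>] cantor_r_Suc_le[OF \<gamma>]
  have le_r: "level_set (cantor_r \<gamma>) s \<subseteq> {0..cantor_r \<gamma> s}" for s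
    by (rule level_set_le) (use r(1)[of s] in simp)
  have next_le: "level_set (cantor_r \<gamma>) (Suc s) \<subseteq> {0..(cantor_r \<gamma> s)\<^sup>2 / 4}" for s
    by (rule order_trans[OF le_r[of "Suc s"]]) (use r(3)[of s] in \<open>simp del: cantor_r.simps\<close>)
  have iff: "x \<in> level_set (cantor_r \<gamma>) s \<longleftrightarrow> x * (cantor_r \<gamma> s - x) \<in> level_set (cantor_r \<gamma>) (Suc s)"
    if "x \<in> {0..cantor_r \<gamma> s}" for x s
    by (subst level_set_iff) (use that in simp)
  note step = energy_minimiser_step[OF _ less_imp_le[OF r(1)] r(2) le_r level_set_borel next_le level_set_borel]
  show *: "energy_minimiser (level_set (cantor_r \<gamma>) s) (pushed_measure M (cantor_r \<gamma>) s)" for s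
  proof (induction s)
    case (Suc s)
    show ?case unfolding pushed_measure.simps
      by (rule step(1)[OF Suc]) (rule iff)
  qed (use min in simp)
  show "(\<integral>x. poly p (cantor_r \<gamma> s - x) \<partial>pushed_measure M (cantor_r \<gamma>) s)
       = (\<integral>x. poly p x \<partial>pushed_measure M (cantor_r \<gamma>) s)"
    by (rule step(2)[OF *]) (rule iff)
qed

definition moment :: "real measure \<Rightarrow> real poly \<Rightarrow> real" where
  "moment M p = (\<integral>x. poly p x \<partial>M)"

lemma moment_functional_moment:
  assumes M: "M \<in> prob_measures_on {0..1}"
  shows "moment_functional (moment M)"
proof
  interpret prob_space M using prob_measures_onD(2)[OF M] .
  have [simp]: "integrable M (poly p)" for p :: "real poly"
    unfolding poly_altdef by (auto intro!: integrable_power_unit[OF M])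
  show "moment M (p + q) = moment M p + moment M q" for p q
    by (simp add: moment_def)
  show "moment M (smult c p) = c * moment M p" for c p
    by (simp add: moment_def)
  show "moment M 1 = 1"
    by (simp add: moment_def prob_space)
qed

lemma moment_distr_pcompose:
  assumes [measurable_cong]: "sets M = sets borel"
  shows "moment (distr M borel (poly q)) p = moment M (pcompose p q)"
proof -
  have [measurable]: "poly f \<in> borel_measurable borel" for f :: "real poly"
    by (intro borel_measurable_continuous_onI continuous_intros)
  have "moment (distr M borel (poly q)) p = (\<integral>x. poly p (poly q x) \<partial>M)"
    unfolding moment_def by (rule integral_distr) measurable
  also have "\<dots> = moment M (pcompose p q)"
    unfolding moment_def by (rule Bochner_Integration.integral_cong) (simp_all add: poly_pcompose)
  finally show ?thesis .
qed

text \<open>The squared Jacobi parameters of stage \<open>s\<close>, obtained by iterating the passage to the even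
  subfamily.\<close>
primrec folded_coeffs :: "(nat \<Rightarrow> real) \<Rightarrow> nat \<Rightarrow> nat \<Rightarrow> real" where
  "folded_coeffs A 0 n = A n"
| "folded_coeffs A (Suc s) n = folded_coeffs A s (2 * n) * folded_coeffs A s (2 * n - 1)"

lemma jacobi_functional_of_orthogonal_polys:
  assumes M: "M \<in> prob_measures_on {0..1}"
    and Q: "is_monic_orthogonal_polys M Q" and ab: "are_jacobi_parameters Q a b" and "a 0 = 0"
  shows "jacobi_functional (moment M) (\<lambda>n. (a n)\<^sup>2) (\<lambda>n. b (Suc n))"
proof -
  interpret moment_functional "moment M" by (rule moment_functional_moment[OF M])
  let ?q = "recurrence_poly (\<lambda>n. (a n)\<^sup>2) (\<lambda>n. b (Suc n))"
  have Q0: "Q 0 = 1"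
  proof -
    have "degree (Q 0) = 0" "coeff (Q 0) 0 = 1"
      using Q by (auto simp: is_monic_orthogonal_polys_def dest: spec[of _ 0])
    thus ?thesis by (metis one_pCons degree_eq_zeroE coeff_pCons_0)
  qed
  have Qq: "?q n = Q n" for n
  proof (induction "\<lambda>n. (a n)\<^sup>2" "\<lambda>n. b (Suc n)" n rule: recurrence_poly.induct)
    case 1
    show ?case using Q0 by simp
  next
    case 2
    show ?case using ab Q0 by (simp add: are_jacobi_parameters_def)
  next
    case (3 n)
    thus ?case using ab by (simp add: are_jacobi_parameters_def)
  qed
  show ?thesis
  proof
    show "(a 0)\<^sup>2 = 0" using \<open>a 0 = 0\<close> by simp
    show "0 < (a n)\<^sup>2" if "n \<ge> 1" for n
      using ab that by (force simp: are_jacobi_parameters_def)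
    show "moment M (?q n * p) = 0" if "degree p < n" for p n
      using Q that unfolding Qq is_monic_orthogonal_polys_def by (simp add: moment_def)
  qed
qed

text \<open>Folding produces recurrence coefficients \<open>b n = (r s)\<^sup>2 / 4 - A s (2 n) - A s (2 n + 1)\<close> at stage
  \<open>s + 1\<close>. The folded measure is symmetric about \<open>r (s + 1) / 2\<close>, so they must all equal that
  number; this is the sum rule.\<close>
theorem folded_jacobi_functional:
  assumes \<gamma>: "\<forall>s\<ge>1. 0 < \<gamma> s \<and> \<gamma> s < 1 / 4"
    and min: "energy_minimiser (level_set (cantor_r \<gamma>) 0) M"
    and J: "jacobi_functional (moment M) A b"
  shows "jacobi_functional (moment (pushed_measure M (cantor_r \<gamma>) s)) (folded_coeffs A s) (\<lambda>_. cantor_r \<gamma> s / 2)"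
    and "folded_coeffs A s (2 * n) + folded_coeffs A s (2 * n + 1) = (cantor_r \<gamma> s)\<^sup>2 / 4 - cantor_r \<gamma> (Suc s) / 2"
proof -
  let ?L = "\<lambda>s. moment (pushed_measure M (cantor_r \<gamma>) s)"
  have const: "\<beta> n = cantor_r \<gamma> s / 2" if "jacobi_functional (?L s) B \<beta>" for s B \<beta> n
  proof (rule jacobi_functional.symmetric_imp_b_const[OF that])
    show "?L s (pcompose p [:cantor_r \<gamma> s, - 1:]) = ?L s p" for p
      using pushed_measure_minimises(2)[OF \<gamma> min, where p = p and s = s] by (simp add: moment_def poly_pcompose)
  qed
  have sets: "sets (pushed_measure M (cantor_r \<gamma>) s) = sets borel" for s
    using pushed_measure_minimises(1)[OF \<gamma> min, of s] prob_measures_onD(1) by (auto simp: energy_minimiser_def)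
  have push: "?L (Suc s) = (\<lambda>p. ?L s (pcompose p [:0, cantor_r \<gamma> s, - 1:]))" for s
  proof -
    have "poly [:0, cantor_r \<gamma> s, - 1:] = (\<lambda>x. x * (cantor_r \<gamma> s - x))"
      by (auto simp: algebra_simps)
    thus ?thesis
      using moment_distr_pcompose[OF sets[of s], of "[:0, cantor_r \<gamma> s, - 1:]"] by auto
  qed
  have fold: "jacobi_functional (?L (Suc s)) (folded_coeffs A (Suc s))
      (\<lambda>n. (cantor_r \<gamma> s)\<^sup>2 / 4 - folded_coeffs A s (2 * n) - folded_coeffs A s (2 * n + 1))"
    if "jacobi_functional (?L s) (folded_coeffs A s) (\<lambda>_. cantor_r \<gamma> s / 2)" for s
  proof -
    have "folded_coeffs A (Suc s) = (\<lambda>n. folded_coeffs A s (2 * n) * folded_coeffs A s (2 * n - 1))"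
      by (rule ext) simp
    thus ?thesis
      using symmetric_jacobi_functional.even_jacobi_functional[OF symmetric_jacobi_functional.intro[OF that]]
      unfolding push by (simp only:)
  qed
  show *: "jacobi_functional (?L s) (folded_coeffs A s) (\<lambda>_. cantor_r \<gamma> s / 2)" for s
  proof (induction s)
    case 0
    have "b = (\<lambda>_. cantor_r \<gamma> 0 / 2)" using const[of 0 A b] J by auto
    with J show ?case by simp
  next
    case (Suc s)
    from const[OF fold[OF Suc]] fold[OF Suc] show ?case by (simp only:)
  qed
  show "folded_coeffs A s (2 * n) + folded_coeffs A s (2 * n + 1) = (cantor_r \<gamma> s)\<^sup>2 / 4 - cantor_r \<gamma> (Suc s) / 2"
    using const[OF fold[OF *[of s]], of n] by linarith
qed

theorem theorem4p7:
  fixes \<gamma> :: "nat \<Rightarrow> real"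
    and \<mu> :: "real measure"
    and Q :: "nat \<Rightarrow> real poly"
    and a b :: "nat \<Rightarrow> real"
  assumes "\<And>s. s \<ge> 1 \<Longrightarrow> 0 < \<gamma> s \<and> \<gamma> s < 1 / 4"
    and "log_capacity (cantor_K \<gamma>) > 0"
    and "is_equilibrium_measure (cantor_K \<gamma>) \<mu>"
    and "is_monic_orthogonal_polys \<mu> Q"
    and "are_jacobi_parameters Q a b"
    and "\<And>s. s \<ge> 1 \<Longrightarrow> \<gamma> s \<le> 1 / 6"
    and "a 0 = 0"
  shows "(\<forall>j\<ge>1. \<forall>n. (\<lambda>s. a (j * 2 ^ s + n)) \<longlonglongrightarrow> a n)
       \<and> liminf (\<lambda>n. ereal (a n)) = 0"
proof -
  let ?r = "cantor_r \<gamma>"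
  define A where "A = folded_coeffs (\<lambda>n. (a n)\<^sup>2)"
  define \<alpha> where "\<alpha> = (\<lambda>s n. A s n / (?r s)\<^sup>2)"
  have \<gamma>: "\<forall>s\<ge>1. 0 < \<gamma> s \<and> \<gamma> s < 1 / 4" using assms(1) by blast
  note r = cantor_r_pos[OF \<gamma>] cantor_r_le_1[OF \<gamma>] cantor_r_Suc_le[OF \<gamma>]
  have unit: "level_set ?r 0 \<subseteq> {0..1}"
    using level_set_le[of ?r 0] by simp
  have min: "energy_minimiser (level_set ?r 0) \<mu>"
    using equilibrium_measure_minimises[of "cantor_K \<gamma>" \<mu>] assms(2,3) unit
    unfolding cantor_K_eq_level_set by simp
  have "\<mu> \<in> prob_measures_on {0..1}"
    by (rule prob_measures_on_mono[OF _ unit]) (use min in \<open>auto simp: energy_minimiser_def\<close>)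
  from jacobi_functional_of_orthogonal_polys[OF this assms(4,5,7)]
  have J: "jacobi_functional (moment \<mu>) (\<lambda>n. (a n)\<^sup>2) (\<lambda>n. b (Suc n))" .
  note fold = folded_jacobi_functional[OF \<gamma> min J, folded A_def]
  have A_0: "A s 0 = 0" and A_pos: "n \<ge> 1 \<Longrightarrow> A s n > 0" for s n
    using fold(1)[of s] by (auto simp: jacobi_functional_def jacobi_functional_axioms_def)
  have nonneg: "a n \<ge> 0" for n
    using assms(5,7) by (cases n) (auto simp: are_jacobi_parameters_def less_imp_le)
  have "(\<lambda>s. \<alpha> t (j * 2 ^ s + n)) \<longlonglongrightarrow> \<alpha> t n" for t j n
  proof (rule renormalised_limit[where \<gamma> = "\<lambda>t. \<gamma> (Suc t)"])
    show "0 < \<gamma> (Suc t) \<and> \<gamma> (Suc t) \<le> 1 / 6" for t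
      using assms(1,6)[of "Suc t"] by simp
    show "\<alpha> t 0 = 0" for t by (simp add: \<alpha>_def A_0)
    show "\<alpha> t n > 0" if "n \<ge> 1" for t n
      using A_pos[OF that] r(1)[of t] by (simp add: \<alpha>_def)
    show "\<alpha> t (2 * n) + \<alpha> t (2 * n + 1) = 1 / 4 - \<gamma> (Suc t) / 2" for t n
      using fold(2)[of t n] r(1)[of t]
      by (simp add: \<alpha>_def field_simps flip: add_divide_distrib)
    show "\<alpha> t (2 * n) * \<alpha> t (2 * n - 1) = (\<gamma> (Suc t))\<^sup>2 * \<alpha> (Suc t) n" for t n
    proof -
      have "A (Suc t) n = A t (2 * n) * A t (2 * n - 1)" by (simp add: A_def)
      thus ?thesis using r(1)[of t] assms(1)[of "Suc t"]
        by (simp add: \<alpha>_def power_mult_distrib power2_eq_square)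
    qed
  qed
  \<comment> \<open>Stage \<open>0\<close> has \<open>r 0 = 1\<close> and the original squared parameters.\<close>
  from this[of 0] have "(\<lambda>s. sqrt ((a (j * 2 ^ s + n))\<^sup>2)) \<longlonglongrightarrow> sqrt ((a n)\<^sup>2)" for j n
    by (intro tendsto_real_sqrt) (simp add: \<alpha>_def A_def)
  hence lim: "(\<lambda>s. a (j * 2 ^ s + n)) \<longlonglongrightarrow> a n" for j n
    using nonneg by simp
  have "liminf (\<lambda>n. ereal (a n)) \<le> liminf ((\<lambda>n. ereal (a n)) \<circ> (\<lambda>s. 2 ^ s))"
    by (rule liminf_subseq_mono) (simp add: strict_mono_def)
  also have "\<dots> = ereal 0"
    using lim[of 1 0] assms(7) by (intro lim_imp_Liminf) (auto simp: comp_def)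
  finally have "liminf (\<lambda>n. ereal (a n)) = 0"
    using nonneg by (intro antisym Liminf_bounded) (auto simp: zero_ereal_def)
  with lim show ?thesis by blast
qed

end
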